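(* Let $(A_0,A_1)$ be a quasi-Banach couple such that $A_0\cap A_1$ is not closed in $A_0+A_1$. If $0<\theta_0<1/2<\theta_1<1$ and $0<p,q<\infty$, then $$(A_0,A_1)_{\theta_0,p}\neq (A_0,A_1)_{\theta_1,q}.$$ Moreover, if $0<p,q<\infty$ and $$(A_0,A_1)_{\theta_0,p}=(A_0,A_1)_{\theta_1,q}$$ with $0<\theta_0<\theta_1\le\frac12$ or $\frac12\le\theta_0<\theta_1<1$, then all the spaces $(A_0,A_1)_{\theta,r}$, $\theta\in[\theta_0,\theta_1]$, $0<r<\infty$, collapse into a unique space (i.e. they are all equal), and $$(A_1,A_0)_{\phi_0,r_0}\neq (A_1,A_0)_{\phi_1,r_1}$$ whenever $\phi_0,\phi_1\in[\theta_0,\theta_1]$, $\phi_0\neq\phi_1$, and $0<r_0,r_1<\infty$.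
   Context: A quasi-Banach couple $(A_0,A_1)$ consists of two quasi-Banach spaces (complete quasi-normed spaces) continuously embedded in a common Hausdorff topological vector space. For $x\in A_0+A_1$ and $t>0$, $K(x,t,A_0,A_1)=\inf\{\|a_0\|_{A_0}+t\|a_1\|_{A_1}: x=a_0+a_1,\ a_j\in A_j,\ j=0,1\}$. The sum carries the quasi-norm $\|x\|_{A_0+A_1}=K(x,1,A_0,A_1)$. For $0<\theta<1$ and $0<p<\infty$, $(A_0,A_1)_{\theta,p}$ is the space of all $x\in A_0+A_1$ with $\|x\|_{(A_0,A_1)_{\theta,p}}=\left(\int_0^\infty (t^{-\theta}K(x,t,A_0,A_1))^p\frac{dt}{t}\right)^{1/p}<\infty$; $(A_1,A_0)_{\theta,p}$ is defined in the same way with the roles of $A_0$ and $A_1$ exchanged. Equality of such spaces means equality as sets (the quasi-norms are then automatically equivalent). *)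

theory Defs
  imports "HOL-Analysis.Analysis"
begin

class hausdorff_tvs = real_vector + topological_group_add + t2_space +
  assumes tendsto_scaleR_nhds:
    "((\<lambda>z. fst z *\<^sub>R snd z) \<longlongrightarrow> r *\<^sub>R a) (nhds r \<times>\<^sub>F nhds a)"

instance real_normed_vector \<subseteq> hausdorff_tvs
proof
  fix r :: real and a :: 'a
  show "((\<lambda>z. fst z *\<^sub>R snd z) \<longlongrightarrow> r *\<^sub>R a) (nhds r \<times>\<^sub>F nhds a)"
    by (intro tendsto_scaleR) (simp_all add: filterlim_fst filterlim_snd)
qed

text \<open>A space is a subspace \<^term>\<open>A\<close> of the ambient vector space together with a
  functional \<^term>\<open>N\<close>, of which only the values on \<^term>\<open>A\<close> matter.\<close>

definition quasi_norm_on :: "'a::real_vector set \<Rightarrow> ('a \<Rightarrow> real) \<Rightarrow> bool" where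
  "quasi_norm_on A N \<longleftrightarrow>
     subspace A \<and>
     (\<forall>x\<in>A. 0 \<le> N x) \<and>
     (\<forall>x\<in>A. N x = 0 \<longleftrightarrow> x = 0) \<and>
     (\<forall>c. \<forall>x\<in>A. N (c *\<^sub>R x) = \<bar>c\<bar> * N x) \<and>
     (\<exists>C\<ge>1. \<forall>x\<in>A. \<forall>y\<in>A. N (x + y) \<le> C * (N x + N y))"

definition quasi_norm_complete :: "'a::real_vector set \<Rightarrow> ('a \<Rightarrow> real) \<Rightarrow> bool" where
  "quasi_norm_complete A N \<longleftrightarrow>
     (\<forall>s. (\<forall>n::nat. s n \<in> A) \<and> (\<forall>e>0. \<exists>M. \<forall>m\<ge>M. \<forall>n\<ge>M. N (s m - s n) < e)
        \<longrightarrow> (\<exists>l\<in>A. (\<lambda>n. N (s n - l)) \<longlonglongrightarrow> 0))"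

definition quasi_banach_on :: "'a::real_vector set \<Rightarrow> ('a \<Rightarrow> real) \<Rightarrow> bool" where
  "quasi_banach_on A N \<longleftrightarrow> quasi_norm_on A N \<and> quasi_norm_complete A N"

text \<open>Balls of a quasi-norm need not be open; a set is open iff it contains a ball around
  each of its points.\<close>

definition quasi_norm_topology :: "'a::real_vector set \<Rightarrow> ('a \<Rightarrow> real) \<Rightarrow> 'a topology" where
  "quasi_norm_topology A N =
     topology (\<lambda>U. U \<subseteq> A \<and> (\<forall>x\<in>U. \<exists>e>0. {y\<in>A. N (y - x) < e} \<subseteq> U))"

lemma openin_quasi_norm_topology:
  "openin (quasi_norm_topology A N) U \<longleftrightarrow>
     U \<subseteq> A \<and> (\<forall>x\<in>U. \<exists>e>0. {y\<in>A. N (y - x) < e} \<subseteq> U)"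
proof -
  have "istopology (\<lambda>U. U \<subseteq> A \<and> (\<forall>x\<in>U. \<exists>e>0. {y\<in>A. N (y - x) < e} \<subseteq> U))"
    unfolding istopology_def
  proof (intro conjI allI impI)
    fix S T
    assume S: "S \<subseteq> A \<and> (\<forall>x\<in>S. \<exists>e>0. {y\<in>A. N (y - x) < e} \<subseteq> S)"
      and T: "T \<subseteq> A \<and> (\<forall>x\<in>T. \<exists>e>0. {y\<in>A. N (y - x) < e} \<subseteq> T)"
    show "S \<inter> T \<subseteq> A" using S by blast
    show "\<forall>x\<in>S \<inter> T. \<exists>e>0. {y\<in>A. N (y - x) < e} \<subseteq> S \<inter> T"
    proof
      fix x assume "x \<in> S \<inter> T"
      then obtain d e where "d > 0" "{y\<in>A. N (y - x) < d} \<subseteq> S"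
        and "e > 0" "{y\<in>A. N (y - x) < e} \<subseteq> T" using S T by blast
      then have "min d e > 0" "{y\<in>A. N (y - x) < min d e} \<subseteq> S \<inter> T" by auto
      then show "\<exists>e>0. {y\<in>A. N (y - x) < e} \<subseteq> S \<inter> T" by blast
    qed
  next
    fix K
    assume K: "\<forall>U\<in>K. U \<subseteq> A \<and> (\<forall>x\<in>U. \<exists>e>0. {y\<in>A. N (y - x) < e} \<subseteq> U)"
    then show "\<Union>K \<subseteq> A" by blast
    show "\<forall>x\<in>\<Union>K. \<exists>e>0. {y\<in>A. N (y - x) < e} \<subseteq> \<Union>K"
      using K by (meson Union_iff Union_upper subset_trans)
  qed
  then show ?thesis
    by (simp add: quasi_norm_topology_def topology_inverse')
qed

lemma topspace_quasi_norm_topology [simp]: "topspace (quasi_norm_topology A N) = A"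
proof
  show "topspace (quasi_norm_topology A N) \<subseteq> A"
    using openin_topspace openin_quasi_norm_topology by blast
  have "openin (quasi_norm_topology A N) A"
    by (auto simp: openin_quasi_norm_topology intro: exI[of _ 1])
  then show "A \<subseteq> topspace (quasi_norm_topology A N)"
    by (rule openin_subset)
qed

definition quasi_banach_couple ::
    "'a::hausdorff_tvs set \<Rightarrow> ('a \<Rightarrow> real) \<Rightarrow> 'a set \<Rightarrow> ('a \<Rightarrow> real) \<Rightarrow> bool" where
  "quasi_banach_couple A0 N0 A1 N1 \<longleftrightarrow>
     quasi_banach_on A0 N0 \<and> quasi_banach_on A1 N1 \<and>
     continuous_map (quasi_norm_topology A0 N0) euclidean (\<lambda>x. x) \<and>
     continuous_map (quasi_norm_topology A1 N1) euclidean (\<lambda>x. x)"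

definition sum_space :: "'a::real_vector set \<Rightarrow> 'a set \<Rightarrow> 'a set" where
  "sum_space A0 A1 = {a0 + a1 | a0 a1. a0 \<in> A0 \<and> a1 \<in> A1}"

definition K_functional ::
    "'a::real_vector set \<Rightarrow> ('a \<Rightarrow> real) \<Rightarrow> 'a set \<Rightarrow> ('a \<Rightarrow> real) \<Rightarrow> 'a \<Rightarrow> real \<Rightarrow> real" where
  "K_functional A0 N0 A1 N1 x t =
     Inf {N0 a0 + t * N1 a1 | a0 a1. a0 \<in> A0 \<and> a1 \<in> A1 \<and> x = a0 + a1}"

definition sum_qnorm ::
    "'a::real_vector set \<Rightarrow> ('a \<Rightarrow> real) \<Rightarrow> 'a set \<Rightarrow> ('a \<Rightarrow> real) \<Rightarrow> 'a \<Rightarrow> real" where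
  "sum_qnorm A0 N0 A1 N1 x = K_functional A0 N0 A1 N1 x 1"

text \<open>The library has no real powers on \<^typ>\<open>ennreal\<close>; the power \<open>1/p\<close> of the possibly
  infinite integral is therefore taken by cases.\<close>

definition interp_qnorm ::
    "'a::real_vector set \<Rightarrow> ('a \<Rightarrow> real) \<Rightarrow> 'a set \<Rightarrow> ('a \<Rightarrow> real) \<Rightarrow> real \<Rightarrow> real \<Rightarrow> 'a \<Rightarrow> ennreal" where
  "interp_qnorm A0 N0 A1 N1 \<theta> p x =
     (let I = (\<integral>\<^sup>+t\<in>{0<..}. ennreal ((t powr (- \<theta>) * K_functional A0 N0 A1 N1 x t) powr p / t) \<partial>lborel)
      in if I = \<infinity> then \<infinity> else ennreal (enn2real I powr (1 / p)))"

definition interp_space ::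
    "'a::real_vector set \<Rightarrow> ('a \<Rightarrow> real) \<Rightarrow> 'a set \<Rightarrow> ('a \<Rightarrow> real) \<Rightarrow> real \<Rightarrow> real \<Rightarrow> 'a set" where
  "interp_space A0 N0 A1 N1 \<theta> p = {x \<in> sum_space A0 A1. interp_qnorm A0 N0 A1 N1 \<theta> p x < \<infinity>}"

lemma mem_interp_space_iff:
  "x \<in> interp_space A0 N0 A1 N1 \<theta> p \<longleftrightarrow>
     x \<in> sum_space A0 A1 \<and>
     (\<integral>\<^sup>+t\<in>{0<..}. ennreal ((t powr (- \<theta>) * K_functional A0 N0 A1 N1 x t) powr p / t) \<partial>lborel) < \<infinity>"
  by (auto simp: interp_space_def interp_qnorm_def Let_def less_top)

end

theory Submission
  imports Defs
begin

text \<open>Two spaces \<open>(A\<^sub>0,A\<^sub>1)\<^bsub>\<theta>,p\<^esub>\<close> with different \<open>\<theta>\<close> can never coincide when \<open>A\<^sub>0 \<inter> A\<^sub>1\<close>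
  is not closed in \<open>A\<^sub>0 + A\<^sub>1\<close>; the value \<open>1/2\<close> plays no role and the hypothesis of the second
  assertion is never satisfied.

  Let \<open>\<theta>\<^sub>0 < \<theta>\<^sub>1\<close>. If the \<open>\<theta>\<^sub>1\<close>-space lies in the \<open>\<theta>\<^sub>0\<close>-space, a gliding hump bounds
  \<open>M = sup\<^sub>t t\<^sup>-\<^sup>\<theta>\<^sup>0 K(y,t)\<close>, uniformly for \<open>y\<close> in \<open>A\<^sub>0 \<inter> A\<^sub>1\<close>, by
  \<open>sup\<^sub>t K(y,t) / min(t\<^sup>\<alpha>,t\<^sup>\<beta>)\<close> with \<open>\<theta>\<^sub>0 < \<alpha> < \<theta>\<^sub>1 < \<beta>\<close>. In the latter the part \<open>t \<ge> s\<close> is at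
  most \<open>s\<^sup>\<theta>\<^sup>0\<^sup>-\<^sup>\<alpha> M\<close>, which is absorbed for large \<open>s\<close>, and \<open>K(y,t) \<le> t N\<^sub>1(y)\<close> controls the rest, so
  \<open>K(y,t) \<le> M' N\<^sub>1(y) t\<^sup>\<theta>\<^sup>0\<close>. For large \<open>t\<close> this splits off from \<open>y\<close> an element of \<open>A\<^sub>0\<close> of norm
  \<open>O(N\<^sub>1(y))\<close>, the remainder having a small multiple of \<open>N\<^sub>1(y)\<close> as its norm in \<open>A\<^sub>1\<close>; iterating gives
  \<open>N\<^sub>0(y) \<le> C N\<^sub>1(y)\<close>. The opposite inclusion gives \<open>N\<^sub>1(y) \<le> C N\<^sub>0(y)\<close> by exchanging \<open>A\<^sub>0\<close> and \<open>A\<^sub>1\<close>.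
  When both norms are equivalent on \<open>A\<^sub>0 \<inter> A\<^sub>1\<close>, the intersection is closed in the sum.\<close>

section \<open>Geometric series in quasi-normed spaces\<close>

text \<open>Splitting off the first term costs a factor \<open>c\<close> at every step;
  \<open>c * d \<le> 1/2\<close> outweighs it, so the induction closes with a constant independent
  of the number of terms. The function \<open>f\<close> is arbitrary so that both a quasi-norm and
  \<open>K _ t\<close> for fixed \<open>t\<close> can be inserted.\<close>

lemma quasi_sum_bound:
  fixes f :: "'a::real_vector \<Rightarrow> real" and b :: "nat \<Rightarrow> 'a"
  assumes S: "subspace S"
    and tri: "\<And>x y. x \<in> S \<Longrightarrow> y \<in> S \<Longrightarrow> f (x + y) \<le> c * (f x + f y)"
    and f0: "f 0 \<le> 0"
    and b: "\<And>k. b k \<in> S" "\<And>k. f (b k) \<le> B * d ^ k"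
    and c: "1 \<le> c" and d: "0 \<le> d" "c * d \<le> 1/2" and B: "0 \<le> B"
  shows "f (\<Sum>k=m..<n. b k) \<le> 2 * c * B * d ^ m"
proof (induction "n - m" arbitrary: m)
  case 0
  then have "n \<le> m" by simp
  then show ?case using f0 c d B by (simp add: order.trans[of _ 0])
next
  case (Suc k)
  then have mn: "m < n" and "k = n - Suc m" by auto
  then have IH: "f (\<Sum>k=Suc m..<n. b k) \<le> 2 * c * B * d ^ Suc m"
    using Suc(1) by blast
  have "(\<Sum>k=m..<n. b k) = b m + (\<Sum>k=Suc m..<n. b k)"
    using mn by (simp add: sum.atLeast_Suc_lessThan)
  also have "f \<dots> \<le> c * (f (b m) + f (\<Sum>k=Suc m..<n. b k))"
    using b S by (intro tri subspace_sum) auto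
  also have "\<dots> \<le> c * (B * d ^ m + 2 * c * B * d ^ Suc m)"
    using IH b(2)[of m] c by (intro mult_left_mono add_mono) auto
  also have "\<dots> = c * (B * d ^ m) * (1 + 2 * (c * d))"
    by (simp add: algebra_simps)
  also have "\<dots> \<le> c * (B * d ^ m) * 2"
    using c d B by (intro mult_left_mono) auto
  finally show ?case by (simp add: algebra_simps)
qed

lemma quasi_norm_onD:
  assumes "quasi_norm_on A N"
  shows "subspace A" "x \<in> A \<Longrightarrow> 0 \<le> N x" "x \<in> A \<Longrightarrow> N x = 0 \<longleftrightarrow> x = 0"
    "x \<in> A \<Longrightarrow> N (r *\<^sub>R x) = \<bar>r\<bar> * N x" "x \<in> A \<Longrightarrow> N (- x) = N x"
    "x \<in> A \<Longrightarrow> y \<in> A \<Longrightarrow> N (x - y) = N (y - x)"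
proof -
  show sub: "subspace A" and "x \<in> A \<Longrightarrow> 0 \<le> N x" "x \<in> A \<Longrightarrow> N x = 0 \<longleftrightarrow> x = 0"
    and scale: "\<And>r x. x \<in> A \<Longrightarrow> N (r *\<^sub>R x) = \<bar>r\<bar> * N x"
    using assms by (auto simp: quasi_norm_on_def)
  show neg: "\<And>x. x \<in> A \<Longrightarrow> N (- x) = N x"
    using scale[of _ "-1"] by simp
  show "x \<in> A \<Longrightarrow> y \<in> A \<Longrightarrow> N (x - y) = N (y - x)"
    using neg[of "x - y"] sub by (simp add: subspace_diff)
qed

text \<open>The partial sums are Cauchy by \<open>quasi_sum_bound\<close>. A quasi-norm need not be
  continuous, so the bound reaches the limit only through the triangle inequality, which adds the
  second factor \<open>c\<close>.\<close>

lemma quasi_banach_series: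
  assumes A: "quasi_banach_on A N"
    and tri: "\<And>x y. x \<in> A \<Longrightarrow> y \<in> A \<Longrightarrow> N (x + y) \<le> c * (N x + N y)"
    and b: "\<And>k. b k \<in> A" "\<And>k. N (b k) \<le> B * d ^ k"
    and c: "1 \<le> c" and d: "0 \<le> d" "c * d \<le> 1/2" and B: "0 \<le> B"
  obtains l where "l \<in> A" "(\<lambda>n. N ((\<Sum>k<n. b k) - l)) \<longlonglongrightarrow> 0" "N l \<le> 2 * c\<^sup>2 * B"
proof -
  have qn: "quasi_norm_on A N" and comp: "quasi_norm_complete A N"
    using A by (auto simp: quasi_banach_on_def)
  note N = quasi_norm_onD[OF qn]
  have N0: "N 0 = 0" using N(1,3) subspace_0 by blast
  define s where "s n = (\<Sum>k<n. b k)" for n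
  have sA: "s n \<in> A" for n unfolding s_def using N(1) b by (intro subspace_sum) auto
  have bound: "N (\<Sum>k=m..<n. b k) \<le> 2 * c * B * d ^ m" for m n
    using N(1) tri N0 b c d B by (intro quasi_sum_bound[where S = A]) auto
  have diff: "N (s n - s m) \<le> 2 * c * B * d ^ m" if "m \<le> n" for m n
  proof -
    have "s n - s m = (\<Sum>k=m..<n. b k)"
      unfolding s_def lessThan_atLeast0 by (rule sum_diff_nat_ivl) (use that in auto)
    then show ?thesis using bound by simp
  qed
  have "c * d \<ge> 1 * d" using c d by (intro mult_right_mono) auto
  then have d1: "d < 1" using d by linarith
  have lim: "(\<lambda>m. 2 * c * B * d ^ m) \<longlonglongrightarrow> 0"
    using tendsto_mult_right_zero[OF LIMSEQ_realpow_zero[OF d(1) d1]] by simp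
  have "\<forall>e>0. \<exists>M. \<forall>m\<ge>M. \<forall>n\<ge>M. N (s m - s n) < e"
  proof (intro allI impI)
    fix e :: real assume "e > 0"
    then obtain M where M: "\<And>m. m \<ge> M \<Longrightarrow> 2 * c * B * d ^ m < e"
      using order_tendstoD(2)[OF lim] by (auto simp: eventually_sequentially)
    have "N (s m - s n) < e" if "m \<ge> M" "n \<ge> M" for m n
      using diff[of m n] diff[of n m] M[OF that(1)] M[OF that(2)] N(6)[OF sA[of m] sA[of n]]
      by (cases "m \<le> n") auto
    then show "\<exists>M. \<forall>m\<ge>M. \<forall>n\<ge>M. N (s m - s n) < e" by blast
  qed
  then obtain l where l: "l \<in> A" "(\<lambda>n. N (s n - l)) \<longlonglongrightarrow> 0"
    using comp sA unfolding quasi_norm_complete_def by blast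
  have "N l \<le> c * (N (s n - l) + 2 * c * B)" for n
  proof -
    have "N l = N ((l - s n) + s n)" by simp
    also have "\<dots> \<le> c * (N (l - s n) + N (s n))"
      using l sA N(1) by (intro tri) (auto intro: subspace_diff)
    also have "N (l - s n) = N (s n - l)" using l sA N(6) by blast
    also have "N (s n) \<le> 2 * c * B" using bound[of 0 n] by (simp add: s_def lessThan_atLeast0)
    finally show ?thesis using c by simp
  qed
  moreover have "(\<lambda>n. c * (N (s n - l) + 2 * c * B)) \<longlonglongrightarrow> c * (0 + 2 * c * B)"
    by (intro tendsto_intros l)
  ultimately have "N l \<le> c * (0 + 2 * c * B)" by (intro LIMSEQ_le_const) auto
  then have "N l \<le> 2 * c\<^sup>2 * B" by (simp add: power2_eq_square)
  then show ?thesis using that l unfolding s_def by blast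
qed

text \<open>The embedding pulls an ambient neighbourhood of 0 back to a set open for the quasi-norm,
  which contains a ball around 0 and hence a tail of \<open>s\<close>.\<close>

lemma quasi_norm_tendsto_0:
  assumes cont: "continuous_map (quasi_norm_topology A N) euclidean (\<lambda>x::'a::hausdorff_tvs. x)"
    and A: "quasi_norm_on A N" and s: "\<And>n::nat. s n \<in> A" and lim: "(\<lambda>n. N (s n)) \<longlonglongrightarrow> 0"
  shows "s \<longlonglongrightarrow> 0"
proof (rule topological_tendstoI)
  fix U :: "'a set" assume U: "open U" "0 \<in> U"
  have "openin (quasi_norm_topology A N) {x \<in> A. x \<in> U}"
    using cont U(1) unfolding continuous_map by auto
  moreover have "0 \<in> A" using quasi_norm_onD(1)[OF A] subspace_0 by blast
  ultimately obtain e where e: "e > 0" "{y \<in> A. N (y - 0) < e} \<subseteq> {x \<in> A. x \<in> U}"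
    using U(2) unfolding openin_quasi_norm_topology by blast
  have "\<forall>\<^sub>F n in sequentially. N (s n) < e" using order_tendstoD(2)[OF lim e(1)] .
  then show "\<forall>\<^sub>F n in sequentially. s n \<in> U"
    by eventually_elim (use e s in auto)
qed

section \<open>The K-functional of a couple\<close>

text \<open>One constant \<open>c\<close> for both quasi-norms makes the assumptions symmetric, so
  results carry over to the reversed couple through \<open>swap\<close>.\<close>

locale quasi_couple =
  fixes A0 :: "'a::hausdorff_tvs set" and N0 :: "'a \<Rightarrow> real"
    and A1 :: "'a set" and N1 :: "'a \<Rightarrow> real" and c :: real
  assumes couple: "quasi_banach_couple A0 N0 A1 N1"
    and c1: "1 \<le> c"
    and tri0: "x \<in> A0 \<Longrightarrow> y \<in> A0 \<Longrightarrow> N0 (x + y) \<le> c * (N0 x + N0 y)"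
    and tri1: "x \<in> A1 \<Longrightarrow> y \<in> A1 \<Longrightarrow> N1 (x + y) \<le> c * (N1 x + N1 y)"
begin

abbreviation K :: "'a \<Rightarrow> real \<Rightarrow> real" where "K \<equiv> K_functional A0 N0 A1 N1"
abbreviation \<Sigma> :: "'a set" where "\<Sigma> \<equiv> sum_space A0 A1"

lemma qb: "quasi_banach_on A0 N0" "quasi_banach_on A1 N1"
  and qn: "quasi_norm_on A0 N0" "quasi_norm_on A1 N1"
  and emb: "continuous_map (quasi_norm_topology A0 N0) euclidean (\<lambda>x. x)"
    "continuous_map (quasi_norm_topology A1 N1) euclidean (\<lambda>x. x)"
  using couple by (auto simp: quasi_banach_couple_def quasi_banach_on_def)

lemmas n0 = quasi_norm_onD[OF qn(1)] and n1 = quasi_norm_onD[OF qn(2)]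

lemma zero: "N0 0 = 0" "N1 0 = 0" "0 \<in> A0" "0 \<in> A1"
  using n0(1,3) n1(1,3) subspace_0 by blast+

lemma swap: "quasi_couple A1 N1 A0 N0 c"
  using couple c1 tri0 tri1 by unfold_locales (auto simp: quasi_banach_couple_def)

lemma subspace_sum_space: "subspace \<Sigma>"
proof -
  have "\<Sigma> = {x + y |x y. x \<in> A0 \<and> y \<in> A1}" by (auto simp: sum_space_def)
  then show ?thesis using subspace_sums[OF n0(1) n1(1)] by simp
qed

lemma subspace_inter: "subspace (A0 \<inter> A1)"
  using n0(1) n1(1) by (rule subspace_inter)

lemma in_sum: "x \<in> A0 \<Longrightarrow> y \<in> A1 \<Longrightarrow> x + y \<in> \<Sigma>"
  by (auto simp: sum_space_def)

lemma A0_sum: "x \<in> A0 \<Longrightarrow> x \<in> \<Sigma>"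
  using in_sum[of x 0] zero by auto

lemma K_le:
  assumes "a \<in> A0" "b \<in> A1" "0 \<le> t"
  shows "K (a + b) t \<le> N0 a + t * N1 b"
  unfolding K_functional_def
proof (rule cInf_lower)
  show "bdd_below {N0 a0 + t * N1 a1 |a0 a1. a0 \<in> A0 \<and> a1 \<in> A1 \<and> a + b = a0 + a1}"
    using assms n0(2) n1(2) by (intro bdd_belowI[where m = 0]) auto
qed (use assms in auto)

lemma K_le0: "y \<in> A0 \<Longrightarrow> 0 \<le> t \<Longrightarrow> K y t \<le> N0 y"
  and K_le1: "y \<in> A1 \<Longrightarrow> 0 \<le> t \<Longrightarrow> K y t \<le> t * N1 y"
  using K_le[of y 0 t] K_le[of 0 y t] zero by auto

lemma K_greatest:
  assumes "x \<in> \<Sigma>" "\<And>a b. a \<in> A0 \<Longrightarrow> b \<in> A1 \<Longrightarrow> x = a + b \<Longrightarrow> B \<le> N0 a + t * N1 b"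
  shows "B \<le> K x t"
  unfolding K_functional_def using assms by (intro cInf_greatest) (auto simp: sum_space_def)

lemma K_nonneg: "x \<in> \<Sigma> \<Longrightarrow> 0 \<le> t \<Longrightarrow> 0 \<le> K x t"
  using n0(2) n1(2) by (intro K_greatest) auto

lemma K_approx:
  assumes "x \<in> \<Sigma>" "K x t < B"
  obtains a b where "a \<in> A0" "b \<in> A1" "x = a + b" "N0 a + t * N1 b < B"
  using K_greatest[OF assms(1), of B t] assms(2) by fastforce

lemma K_mono:
  assumes "x \<in> \<Sigma>" "0 \<le> s" "s \<le> t"
  shows "K x s \<le> K x t"
proof (rule K_greatest[OF assms(1)])
  fix a b assume ab: "a \<in> A0" "b \<in> A1" "x = a + b"
  then have "K x s \<le> N0 a + s * N1 b" using K_le assms by blast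
  also have "\<dots> \<le> N0 a + t * N1 b" using assms n1(2) ab by (simp add: mult_right_mono)
  finally show "K x s \<le> N0 a + t * N1 b" .
qed

lemma K_scale:
  assumes "x \<in> \<Sigma>" "0 \<le> t"
  shows "K (r *\<^sub>R x) t \<le> \<bar>r\<bar> * K x t"
proof (cases "r = 0")
  case True
  then show ?thesis using K_le0[of 0 t] zero assms by simp
next
  case False
  have "K (r *\<^sub>R x) t / \<bar>r\<bar> \<le> K x t"
  proof (rule K_greatest[OF assms(1)])
    fix a b assume ab: "a \<in> A0" "b \<in> A1" "x = a + b"
    then have "K (r *\<^sub>R x) t \<le> N0 (r *\<^sub>R a) + t * N1 (r *\<^sub>R b)"
      using K_le[of "r *\<^sub>R a" "r *\<^sub>R b" t] n0(1) n1(1) assms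
      by (auto simp: scaleR_add_right subspace_scale)
    also have "\<dots> = \<bar>r\<bar> * (N0 a + t * N1 b)"
      using ab n0(4) n1(4) by (simp add: algebra_simps)
    finally show "K (r *\<^sub>R x) t / \<bar>r\<bar> \<le> N0 a + t * N1 b"
      using False by (simp add: divide_simps mult.commute)
  qed
  then show ?thesis using False by (simp add: divide_simps mult.commute)
qed

lemma K_neg: "x \<in> \<Sigma> \<Longrightarrow> 0 \<le> t \<Longrightarrow> K (- x) t = K x t"
  using K_scale[of x t "-1"] K_scale[of "- x" t "-1"] subspace_sum_space
  by (simp add: subspace_neg)

lemma K_commute: "x \<in> \<Sigma> \<Longrightarrow> y \<in> \<Sigma> \<Longrightarrow> 0 \<le> t \<Longrightarrow> K (x - y) t = K (y - x) t"
  using K_neg[of "x - y" t] subspace_sum_space by (simp add: subspace_diff)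

lemma K_triangle:
  assumes "x \<in> \<Sigma>" "y \<in> \<Sigma>" "0 \<le> t"
  shows "K (x + y) t \<le> c * (K x t + K y t)"
proof (rule field_le_epsilon)
  fix e :: real assume e: "e > 0"
  \<comment> \<open>The infimum need not be attained; the two errors \<open>d\<close>, multiplied by
    \<open>c\<close>, add up to \<open>e\<close>.\<close>
  define d where "d = e / (2 * c)"
  have d: "d > 0" using e c1 by (simp add: d_def)
  obtain a b where ab: "a \<in> A0" "b \<in> A1" "x = a + b" "N0 a + t * N1 b < K x t + d"
    using K_approx[OF assms(1), of t "K x t + d"] d by auto
  obtain a' b' where ab': "a' \<in> A0" "b' \<in> A1" "y = a' + b'" "N0 a' + t * N1 b' < K y t + d"
    using K_approx[OF assms(2), of t "K y t + d"] d by auto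
  have "x + y = (a + a') + (b + b')" using ab ab' by (simp add: algebra_simps)
  then have "K (x + y) t \<le> N0 (a + a') + t * N1 (b + b')"
    using K_le[of "a + a'" "b + b'" t] ab(1,2) ab'(1,2) n0(1) n1(1) assms(3)
    by (simp add: subspace_add)
  also have "\<dots> \<le> c * (N0 a + N0 a') + t * (c * (N1 b + N1 b'))"
    using ab ab' tri0 tri1 assms by (intro add_mono mult_left_mono) auto
  also have "\<dots> = c * ((N0 a + t * N1 b) + (N0 a' + t * N1 b'))" by (simp add: algebra_simps)
  also have "\<dots> \<le> c * ((K x t + d) + (K y t + d))"
    using ab ab' c1 by (intro mult_left_mono) auto
  also have "\<dots> = c * (K x t + K y t) + e" using c1 by (simp add: d_def field_simps)
  finally show "K (x + y) t \<le> c * (K x t + K y t) + e" .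
qed

lemma K_triangle_diff:
  assumes "x \<in> \<Sigma>" "y \<in> \<Sigma>" "0 \<le> t"
  shows "K x t \<le> c * (K y t + K (x - y) t)"
  using K_triangle[of y "x - y" t] assms subspace_sum_space by (simp add: subspace_diff)


lemma tendsto_ambient:
  "(\<And>n. s n \<in> A0) \<Longrightarrow> (\<lambda>n::nat. N0 (s n)) \<longlonglongrightarrow> 0 \<Longrightarrow> s \<longlonglongrightarrow> 0"
  "(\<And>n. s n \<in> A1) \<Longrightarrow> (\<lambda>n::nat. N1 (s n)) \<longlonglongrightarrow> 0 \<Longrightarrow> s \<longlonglongrightarrow> 0"
  using quasi_norm_tendsto_0[OF emb(1) qn(1)] quasi_norm_tendsto_0[OF emb(2) qn(2)] by blast+

section \<open>Uniform bounds by a gliding hump\<close>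

text \<open>A uniform boundedness principle: the hypothesis gives a constant for each element, the
  conclusion one constant for the whole intersection. Otherwise multiples of worse and worse
  elements would add up to an \<open>X\<close> that obeys a bound by \<open>w\<close> and violates
  every bound by \<open>v\<close>.\<close>

lemma uniform_bound:
  assumes w: "\<And>t. 0 < t \<Longrightarrow> 0 \<le> w t" and v: "\<And>t. 0 < t \<Longrightarrow> 0 < v t"
    and hyp: "\<And>x A. x \<in> \<Sigma> \<Longrightarrow> (\<And>t. 0 < t \<Longrightarrow> K x t \<le> A * w t)
      \<Longrightarrow> \<exists>A. \<forall>t>0. K x t \<le> A * v t"
  obtains C where "0 \<le> C" "\<And>y A t. y \<in> A0 \<inter> A1 \<Longrightarrow> 0 \<le> A \<Longrightarrow> (\<And>u. 0 < u \<Longrightarrow> K y u \<le> A * w u)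
      \<Longrightarrow> 0 < t \<Longrightarrow> K y t \<le> C * A * v t"
proof -
  define D where "D = {y \<in> A0 \<inter> A1. \<forall>u>0. K y u \<le> w u}"
  \<comment> \<open>Finite, because \<open>w\<close> bounds all members of \<open>D\<close>
    pointwise. By homogeneity the claim amounts to \<open>\<kappa> t \<le> C * v t\<close>.\<close>
  define \<kappa> where "\<kappa> t = (SUP y\<in>D. K y t)" for t
  have DS: "y \<in> A0" "y \<in> A1" "y \<in> \<Sigma>" if "y \<in> D" for y
    using that A0_sum by (auto simp: D_def)
  have bdd: "bdd_above ((\<lambda>y. K y t) ` D)" if "t > 0" for t
    using that by (intro bdd_aboveI[where M = "w t"]) (auto simp: D_def)
  have K0: "K 0 t \<le> 0" if "t \<ge> 0" for t
    using K_le0[of 0 t] zero that by simp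
  have D0: "0 \<in> D" unfolding D_def using zero order.trans[OF K0 w] by simp
  have \<kappa>: "K y t \<le> \<kappa> t" if "y \<in> D" "t > 0" for y t
    unfolding \<kappa>_def using that bdd by (intro cSUP_upper) auto
  have \<kappa>0: "\<kappa> t \<ge> 0" if "t > 0" for t
    using \<kappa>[OF D0 that] K_nonneg[of 0 t] A0_sum zero that by auto
  have "\<exists>C\<ge>0. \<forall>t>0. \<kappa> t \<le> C * v t"
  proof (rule ccontr)
    assume "\<not> ?thesis"
    then have neg: "\<exists>t>0. \<kappa> t > C * v t" if "C \<ge> 0" for C using that by (meson not_le)
    \<comment> \<open>The ratio must satisfy \<open>c * \<epsilon> \<le> 1/2\<close> for the
      geometric sums, and it makes the tail contribute only
      \<open>2 * c ^ 3 * \<epsilon> = 1 / (8 * c)\<close>, half of the guaranteed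
      \<open>1 / (4 * c)\<close>, both in units of
      \<open>\<epsilon> ^ n * \<kappa> (\<tau> n)\<close>.\<close>
    define \<epsilon> where "\<epsilon> = 1 / (16 * c ^ 4)"
    have \<epsilon>: "\<epsilon> > 0" using c1 by (simp add: \<epsilon>_def)
    have \<epsilon>c3: "2 * c ^ 3 * \<epsilon> = 1 / (8 * c)"
      using c1 by (simp add: \<epsilon>_def field_simps eval_nat_numeral)
    have "c ^ 1 \<le> c ^ 4" using c1 by (intro power_increasing) auto
    then have "c \<le> 8 * c ^ 4" using c1 by simp
    then have \<epsilon>c: "c * \<epsilon> \<le> 1/2" using c1 by (simp add: \<epsilon>_def field_simps)
    \<comment> \<open>The factor \<open>2 / \<epsilon>\<close> compensates the weight
      \<open>\<epsilon> ^ n\<close> of the hump and leaves the growth \<open>2 ^ n\<close>.\<close>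
    have "\<forall>n. \<exists>t>0. \<kappa> t > (2 / \<epsilon>) ^ n * v t" using neg \<epsilon> by simp
    then obtain \<tau> where \<tau>: "\<And>n. \<tau> n > 0" "\<And>n. \<kappa> (\<tau> n) > (2 / \<epsilon>) ^ n * v (\<tau> n)" by metis
    have \<kappa>pos: "\<kappa> (\<tau> n) > 0" for n
      using \<tau>[of n] v \<epsilon> by (smt (verit) divide_pos_pos mult_pos_pos zero_less_power)
    have "\<exists>y\<in>D. K y (\<tau> n) > \<kappa> (\<tau> n) / 2" for n
    proof -
      have "\<kappa> (\<tau> n) / 2 < (SUP y\<in>D. K y (\<tau> n))" using \<kappa>pos[of n] by (simp add: \<kappa>_def)
      then show ?thesis using less_cSUP_iff[OF _ bdd[OF \<tau>(1)]] D0 by blast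
    qed
    then obtain y where y: "\<And>n. y n \<in> D" "\<And>n. K (y n) (\<tau> n) > \<kappa> (\<tau> n) / 2" by metis
    \<comment> \<open>Adding the hump \<open>\<epsilon> ^ n y n\<close> only when the partial sum is still small at \<open>\<tau> n\<close> makes the new
      partial sum large there in either case, without control over the earlier terms.\<close>
    define x where "x = rec_nat 0 (\<lambda>n z. z +
      \<epsilon> ^ n *\<^sub>R (if K z (\<tau> n) \<ge> \<epsilon> ^ n * \<kappa> (\<tau> n) / (4 * c) then 0 else y n))"
    define d where "d n = (if K (x n) (\<tau> n) \<ge> \<epsilon> ^ n * \<kappa> (\<tau> n) / (4 * c) then 0 else y n)" for n
    define z where "z n = \<epsilon> ^ n *\<^sub>R d n" for n
    have x0: "x 0 = 0" and xSuc: "x (Suc n) = x n + z n" for n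
      by (simp_all add: x_def d_def z_def)
    have x_sum: "x n = (\<Sum>k<n. z k)" for n by (induction n) (simp_all add: x0 xSuc)
    have d: "d n \<in> D" for n using y D0 by (simp add: d_def)
    have z: "z n \<in> A0" "z n \<in> A1" "z n \<in> \<Sigma>" for n
      using DS[OF d] n0(1) n1(1) subspace_sum_space by (auto simp: z_def subspace_scale)
    have x: "x n \<in> \<Sigma>" for n unfolding x_sum using z subspace_sum_space by (intro subspace_sum) auto
    have z_le: "K (z n) t \<le> \<epsilon> ^ n * K (d n) t" if "t > 0" for n t
      using K_scale[OF DS(3)[OF d], of t "\<epsilon> ^ n"] that \<epsilon> by (simp add: z_def)
    \<comment> \<open>Two bounds on the same term: the one by \<open>w\<close> gives convergence and
      the growth bound for the limit, the one by \<open>\<kappa>\<close> makes the tail comparable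
      with the hump at \<open>\<tau> n\<close>.\<close>
    have z_w: "K (z n) t \<le> w t * \<epsilon> ^ n" if "t > 0" for n t
    proof -
      have "K (z n) t \<le> \<epsilon> ^ n * K (d n) t" using z_le that .
      also have "\<dots> \<le> \<epsilon> ^ n * w t" using d \<epsilon> that by (intro mult_left_mono) (auto simp: D_def)
      finally show ?thesis by (simp add: mult.commute)
    qed
    have z_\<kappa>: "K (z n) t \<le> \<kappa> t * \<epsilon> ^ n" if "t > 0" for n t
    proof -
      have "K (z n) t \<le> \<epsilon> ^ n * K (d n) t" using z_le that .
      also have "\<dots> \<le> \<epsilon> ^ n * \<kappa> t" using \<kappa>[OF d] \<epsilon> that by (intro mult_left_mono) auto
      finally show ?thesis by (simp add: mult.commute)
    qed
    have sum_w: "K (x n) t \<le> 2 * c * w t" if "t > 0" for n t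
    proof -
      have "K (\<Sum>k=0..<n. z k) t \<le> 2 * c * w t * \<epsilon> ^ 0"
        using that \<epsilon> w
        by (intro quasi_sum_bound[OF subspace_sum_space K_triangle K0 z(3) z_w c1 _ \<epsilon>c]) simp_all
      then show ?thesis by (simp add: x_sum lessThan_atLeast0)
    qed
    have tail: "K (x m - x n) t \<le> 2 * c * \<kappa> t * \<epsilon> ^ n" if "t > 0" "n \<le> m" for m n t
    proof -
      have "x m - x n = (\<Sum>k=n..<m. z k)"
        unfolding x_sum lessThan_atLeast0 by (rule sum_diff_nat_ivl) (use that in auto)
      also have "K \<dots> t \<le> 2 * c * \<kappa> t * \<epsilon> ^ n"
        using that \<epsilon> \<kappa>0
        by (intro quasi_sum_bound[OF subspace_sum_space K_triangle K0 z(3) z_\<kappa> c1 _ \<epsilon>c]) simp_all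
      finally show ?thesis .
    qed
    \<comment> \<open>Adding 1 keeps the bound strict even when \<open>w 1 = 0\<close>, so that
      \<open>K_approx\<close> at \<open>t = 1\<close> splits every term into pieces of geometric
      size. These are summed separately in \<open>A0\<close> and \<open>A1\<close>, where
      completeness is available.\<close>
    have w1: "0 \<le> w 1 + 1" using w[of 1] by simp
    have "\<exists>a b. a \<in> A0 \<and> b \<in> A1 \<and> z n = a + b \<and> N0 a \<le> (w 1 + 1) * \<epsilon> ^ n \<and> N1 b \<le> (w 1 + 1) * \<epsilon> ^ n"
      for n
    proof -
      have "K (z n) 1 < (w 1 + 1) * \<epsilon> ^ n"
        using z_w[of 1 n] zero_less_power[OF \<epsilon>, of n] by (simp add: algebra_simps)
      then obtain a b where ab: "a \<in> A0" "b \<in> A1" "z n = a + b" "N0 a + 1 * N1 b < (w 1 + 1) * \<epsilon> ^ n"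
        using K_approx[OF z(3)] by blast
      then have "N0 a \<ge> 0" "N1 b \<ge> 0" using n0(2) n1(2) by auto
      then have "N0 a \<le> (w 1 + 1) * \<epsilon> ^ n" "N1 b \<le> (w 1 + 1) * \<epsilon> ^ n" using ab(4) by auto
      then show ?thesis using ab by blast
    qed
    then obtain a b where ab: "\<And>n. a n \<in> A0" "\<And>n. b n \<in> A1" "\<And>n. z n = a n + b n"
      "\<And>n. N0 (a n) \<le> (w 1 + 1) * \<epsilon> ^ n" "\<And>n. N1 (b n) \<le> (w 1 + 1) * \<epsilon> ^ n" by metis
    obtain l0 where l0: "l0 \<in> A0" "(\<lambda>n. N0 ((\<Sum>k<n. a k) - l0)) \<longlonglongrightarrow> 0"
      using quasi_banach_series[OF qb(1) tri0 ab(1,4) c1 less_imp_le[OF \<epsilon>] \<epsilon>c w1] by blast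
    obtain l1 where l1: "l1 \<in> A1" "(\<lambda>n. N1 ((\<Sum>k<n. b k) - l1)) \<longlonglongrightarrow> 0"
      using quasi_banach_series[OF qb(2) tri1 ab(2,5) c1 less_imp_le[OF \<epsilon>] \<epsilon>c w1] by blast
    define X where "X = l0 + l1"
    have X: "X \<in> \<Sigma>" using in_sum l0 l1 by (simp add: X_def)
    have xX: "x n - X \<in> \<Sigma>" for n using x X subspace_sum_space by (simp add: subspace_diff)
    have lim: "(\<lambda>n. K (x n - X) t) \<longlonglongrightarrow> 0" if "t > 0" for t
    proof (rule tendsto_sandwich[OF _ _ tendsto_const])
      show "\<forall>\<^sub>F n in sequentially. 0 \<le> K (x n - X) t" using xX K_nonneg that by simp
      have "K (x n - X) t \<le> N0 ((\<Sum>k<n. a k) - l0) + t * N1 ((\<Sum>k<n. b k) - l1)" for n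
      proof -
        have "x n - X = ((\<Sum>k<n. a k) - l0) + ((\<Sum>k<n. b k) - l1)"
          by (simp add: x_sum X_def ab(3) sum.distrib)
        then show ?thesis
          using K_le[of "(\<Sum>k<n. a k) - l0" "(\<Sum>k<n. b k) - l1" t] ab(1,2) l0(1) l1(1) n0(1) n1(1) that
          by (simp add: subspace_diff subspace_sum)
      qed
      then show "\<forall>\<^sub>F n in sequentially. K (x n - X) t
          \<le> N0 ((\<Sum>k<n. a k) - l0) + t * N1 ((\<Sum>k<n. b k) - l1)" by simp
      show "(\<lambda>n. N0 ((\<Sum>k<n. a k) - l0) + t * N1 ((\<Sum>k<n. b k) - l1)) \<longlonglongrightarrow> 0"
        using tendsto_add[OF l0(2) tendsto_mult_right_zero[OF l1(2), of t]] by simp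
    qed
    \<comment> \<open>Passing from the partial sums to \<open>X\<close> costs one more factor
      \<open>c\<close>, since \<open>K _ t\<close> satisfies only a quasi-triangle
      inequality.\<close>
    have "K X t \<le> 2 * c\<^sup>2 * w t" if t: "t > 0" for t
    proof -
      have "K X t \<le> c * (2 * c * w t + K (x n - X) t)" for n
      proof -
        have "K X t \<le> c * (K (x n) t + K (X - x n) t)" using K_triangle_diff[OF X x] t by simp
        also have "\<dots> \<le> c * (2 * c * w t + K (x n - X) t)"
          using sum_w[OF t] K_commute[OF X x, of t n] t c1 by (intro mult_left_mono add_mono) auto
        finally show ?thesis .
      qed
      moreover have "(\<lambda>n. c * (2 * c * w t + K (x n - X) t)) \<longlonglongrightarrow> c * (2 * c * w t + 0)"
        by (intro tendsto_intros lim t)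
      ultimately have "K X t \<le> c * (2 * c * w t + 0)" by (intro LIMSEQ_le_const) auto
      then show ?thesis by (simp add: power2_eq_square algebra_simps)
    qed
    then obtain A where A: "\<And>t. t > 0 \<Longrightarrow> K X t \<le> A * v t" using hyp[OF X] by blast
    have "2 ^ n \<le> 8 * c\<^sup>2 * A" for n :: nat
    proof -
      let ?t = "\<tau> n" and ?k = "\<kappa> (\<tau> n)"
      have t: "?t > 0" using \<tau> by blast
      \<comment> \<open>If nothing was added, the test itself is the bound. Otherwise the hump has
        size at least \<open>\<epsilon> ^ n * ?k / 2\<close>, and the old partial sum, being below
        the threshold, cancels at most half of it.\<close>
      have lower: "\<epsilon> ^ n * ?k / (4 * c) \<le> K (x (Suc n)) ?t"
      proof (cases "K (x n) ?t \<ge> \<epsilon> ^ n * ?k / (4 * c)")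
        case True
        then show ?thesis by (simp add: xSuc z_def d_def)
      next
        case False
        then have dn: "d n = y n" by (simp add: d_def)
        have yz: "y n = (1 / \<epsilon> ^ n) *\<^sub>R z n" using \<epsilon> by (simp add: z_def dn)
        have "?k / 2 < K (y n) ?t" by (rule y)
        also have "\<dots> \<le> \<bar>1 / \<epsilon> ^ n\<bar> * K (z n) ?t" unfolding yz using z t by (intro K_scale) auto
        finally have "\<epsilon> ^ n * ?k / 2 \<le> K (z n) ?t" using \<epsilon> by (simp add: field_simps)
        also have "K (z n) ?t \<le> c * (K (x n) ?t + K (x (Suc n)) ?t)"
          using K_triangle[of "- x n" "x (Suc n)" ?t] x[of n] x[of "Suc n"] K_neg[of "x n" ?t] t
            subspace_sum_space by (simp add: xSuc subspace_neg)
        also have "\<dots> \<le> c * (\<epsilon> ^ n * ?k / (4 * c) + K (x (Suc n)) ?t)"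
          using False c1 by (intro mult_left_mono) auto
        finally show ?thesis using c1 by (simp add: field_simps)
      qed
      \<comment> \<open>The tail estimate, with its upper end \<open>m\<close> sent to
        infinity.\<close>
      have "K (x (Suc n) - X) ?t \<le> c * (2 * c * ?k * \<epsilon> ^ Suc n + 0)"
      proof (rule LIMSEQ_le_const)
        show "(\<lambda>m. c * (2 * c * ?k * \<epsilon> ^ Suc n + K (x m - X) ?t)) \<longlonglongrightarrow> c * (2 * c * ?k * \<epsilon> ^ Suc n + 0)"
          by (intro tendsto_intros lim t)
        have "K (x (Suc n) - X) ?t \<le> c * (2 * c * ?k * \<epsilon> ^ Suc n + K (x m - X) ?t)" if "m \<ge> Suc n" for m
        proof -
          have "K (x (Suc n) - X) ?t \<le> c * (K (x m - X) ?t + K (x (Suc n) - x m) ?t)"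
            using K_triangle_diff[OF xX xX, of ?t "Suc n" m] t by simp
          also have "K (x (Suc n) - x m) ?t \<le> 2 * c * ?k * \<epsilon> ^ Suc n"
            using tail[OF t that] K_commute[OF x x, of ?t "Suc n" m] t by simp
          finally show ?thesis using c1 by (simp add: add.commute)
        qed
        then show "\<exists>N. \<forall>m\<ge>N. K (x (Suc n) - X) ?t \<le> c * (2 * c * ?k * \<epsilon> ^ Suc n + K (x m - X) ?t)"
          by blast
      qed
      moreover have "K (x (Suc n)) ?t \<le> c * (K X ?t + K (x (Suc n) - X) ?t)"
        using K_triangle_diff[OF x X] t by simp
      ultimately have "\<epsilon> ^ n * ?k / (4 * c) \<le> c * (A * v ?t + c * (2 * c * ?k * \<epsilon> ^ Suc n))"
        using lower A[OF t] c1
        by (smt (verit, ccfv_SIG) mult_left_mono)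
      also have "\<dots> = c * A * v ?t + (2 * c ^ 3 * \<epsilon>) * \<epsilon> ^ n * ?k"
        by (simp add: algebra_simps eval_nat_numeral)
      also have "\<dots> = c * A * v ?t + \<epsilon> ^ n * ?k / (8 * c)"
        unfolding \<epsilon>c3 by simp
      finally have "\<epsilon> ^ n * ?k \<le> 8 * c\<^sup>2 * A * v ?t"
        using c1 by (simp add: field_simps power2_eq_square)
      moreover have "2 ^ n * v ?t \<le> \<epsilon> ^ n * ?k"
        using \<tau>(2)[of n] \<epsilon> by (simp add: field_simps power_divide)
      ultimately have "2 ^ n * v ?t \<le> 8 * c\<^sup>2 * A * v ?t" by linarith
      then show ?thesis using v[OF t] by simp
    qed
    moreover obtain n where "8 * c\<^sup>2 * A < 2 ^ n" using real_arch_pow[of 2] by auto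
    ultimately show False by (meson not_le)
  qed
  then obtain C where C: "C \<ge> 0" "\<And>t. t > 0 \<Longrightarrow> \<kappa> t \<le> C * v t" by blast
  show thesis
  proof (rule that[OF C(1)])
    fix y A and t :: real
    assume y: "y \<in> A0 \<inter> A1" and A: "0 \<le> A" and le: "\<And>u. 0 < u \<Longrightarrow> K y u \<le> A * w u" and t: "0 < t"
    have yS: "y \<in> \<Sigma>" using y A0_sum by blast
    show "K y t \<le> C * A * v t"
    \<comment> \<open>Normalising by \<open>1 / A\<close> fails for \<open>A = 0\<close>, where the
      assumption already gives \<open>K y t \<le> 0\<close>.\<close>
    proof (cases "A = 0")
      case True
      then show ?thesis using le[OF t] by simp
    next
      case False
      then have A: "A > 0" using A by simp
      have "K ((1 / A) *\<^sub>R y) u \<le> w u" if "u > 0" for u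
      proof -
        have "K ((1 / A) *\<^sub>R y) u \<le> \<bar>1 / A\<bar> * K y u" using that by (intro K_scale yS) simp
        also have "\<dots> \<le> \<bar>1 / A\<bar> * (A * w u)" using le[OF that] by (intro mult_left_mono) auto
        finally show ?thesis using A by simp
      qed
      then have "(1 / A) *\<^sub>R y \<in> D"
        using y subspace_inter by (auto simp: D_def subspace_scale simp del: Int_iff)
      then have "K ((1 / A) *\<^sub>R y) t \<le> C * v t" using \<kappa> C t by (meson order.trans)
      moreover have "K y t \<le> A * K ((1 / A) *\<^sub>R y) t"
        using K_scale[of "(1 / A) *\<^sub>R y" t A] yS subspace_sum_space t A by (simp add: subspace_scale)
      ultimately show ?thesis using A by (smt (verit) mult.assoc mult.left_commute mult_left_mono)
    qed
  qed
qed

section \<open>From growth of the K-functional to comparison of the quasi-norms\<close>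

text \<open>An absorption argument: the supremum \<open>m\<close> of
  \<open>K y t / t powr \<gamma>\<close> is known to be finite for each \<open>y\<close>, so an
  estimate of \<open>m\<close> by \<open>m / 2\<close> plus a multiple of \<open>N1 y\<close> can be
  solved for \<open>m\<close>.\<close>

lemma norm_growth:
  assumes exps: "0 \<le> \<gamma>" "\<gamma> < \<alpha>" "\<alpha> \<le> \<beta>" "\<beta> \<le> 1"
    and hyp: "\<And>x A. x \<in> \<Sigma> \<Longrightarrow> (\<And>t. 0 < t \<Longrightarrow> K x t \<le> A * min (t powr \<alpha>) (t powr \<beta>))
      \<Longrightarrow> \<exists>A. \<forall>t>0. K x t \<le> A * t powr \<gamma>"
  obtains M where "0 \<le> M" "\<And>y t. y \<in> A0 \<inter> A1 \<Longrightarrow> 0 < t \<Longrightarrow> K y t \<le> M * N1 y * t powr \<gamma>"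
proof -
  obtain C where C: "C \<ge> 0" "\<And>y A t. y \<in> A0 \<inter> A1 \<Longrightarrow> 0 \<le> A
      \<Longrightarrow> (\<And>u. 0 < u \<Longrightarrow> K y u \<le> A * min (u powr \<alpha>) (u powr \<beta>)) \<Longrightarrow> 0 < t \<Longrightarrow> K y t \<le> C * A * t powr \<gamma>"
  proof (rule uniform_bound[of "\<lambda>t. min (t powr \<alpha>) (t powr \<beta>)" "\<lambda>t. t powr \<gamma>"])
    show "\<exists>A. \<forall>t>0. K x t \<le> A * t powr \<gamma>"
      if "x \<in> \<Sigma>" "\<And>t. 0 < t \<Longrightarrow> K x t \<le> A * min (t powr \<alpha>) (t powr \<beta>)" for x A
      using hyp that by blast
  qed auto
  \<comment> \<open>Chosen so that \<open>s powr (\<gamma> - \<alpha>) = 1 / (2 * C + 1)\<close>,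
    which makes the coefficient of \<open>m\<close> at most 1/2.\<close>
  define s where "s = (2 * C + 1) powr (1 / (\<alpha> - \<gamma>))"
  have s: "s \<ge> 1" using C exps by (simp add: s_def ge_one_powr_ge_zero)
  have "s powr (\<gamma> - \<alpha>) = (2 * C + 1) powr ((1 / (\<alpha> - \<gamma>)) * (\<gamma> - \<alpha>))"
    by (simp add: s_def powr_powr)
  also have "(1 / (\<alpha> - \<gamma>)) * (\<gamma> - \<alpha>) = -1" using exps by (simp add: field_simps)
  also have "(2 * C + 1) powr -1 = 1 / (2 * C + 1)" using C by (simp add: powr_minus_divide)
  finally have "s powr (\<gamma> - \<alpha>) = 1 / (2 * C + 1)" .
  then have Cs: "C * s powr (\<gamma> - \<alpha>) \<le> 1 / 2" using C(1) by simp
  show thesis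
  proof (rule that[of "2 * C * s"])
    show "0 \<le> 2 * C * s" using C s by simp
    fix y t assume y: "y \<in> A0 \<inter> A1" and t: "0 < (t::real)"
    define m where "m = (SUP t\<in>{0<..}. K y t / t powr \<gamma>)"
    have N: "N0 y \<ge> 0" "N1 y \<ge> 0" using y n0(2) n1(2) by auto
    \<comment> \<open>This bound only secures finiteness of \<open>m\<close>; \<open>N0 y\<close>
      does not enter the final estimate.\<close>
    have "K y u \<le> (N0 y + N1 y) * u powr \<gamma>" if u: "u > 0" for u
    proof (cases "u \<ge> 1")
      case True
      have "K y u \<le> (N0 y + N1 y) * 1" using K_le0[of y u] y u N by auto
      also have "\<dots> \<le> (N0 y + N1 y) * u powr \<gamma>"
        using True exps N by (intro mult_left_mono) (auto simp: ge_one_powr_ge_zero)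
      finally show ?thesis .
    next
      case False
      have "u powr 1 \<le> u powr \<gamma>" using False u exps by (intro powr_mono') auto
      then have "N1 y * u \<le> N1 y * u powr \<gamma>" using u N by (intro mult_left_mono) auto
      moreover have "0 \<le> N0 y * u powr \<gamma>" using N by simp
      moreover have "K y u \<le> u * N1 y" using K_le1[of y u] y u by auto
      ultimately show ?thesis by (simp add: algebra_simps)
    qed
    then have "bdd_above ((\<lambda>t. K y t / t powr \<gamma>) ` {0<..})"
      by (intro bdd_aboveI[where M = "N0 y + N1 y"]) (auto simp: divide_le_eq)
    then have m: "K y u \<le> m * u powr \<gamma>" if "u > 0" for u
      using cSUP_upper[of u "{0<..}" "\<lambda>t. K y t / t powr \<gamma>"] that by (simp add: m_def divide_le_eq)
    have m0: "m \<ge> 0" using m[of 1] K_nonneg[of y 1] y A0_sum by simp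
    \<comment> \<open>The first summand controls \<open>u \<ge> s\<close>, the second
      \<open>u \<le> s\<close>.\<close>
    define A where "A = s powr (\<gamma> - \<alpha>) * m + s * N1 y"
    have A: "A \<ge> 0" "A \<ge> s powr (\<gamma> - \<alpha>) * m" "A \<ge> s * N1 y" using m0 N s by (auto simp: A_def)
    have "K y u \<le> A * min (u powr \<alpha>) (u powr \<beta>)" if u: "u > 0" for u
    proof -
      consider "u \<le> 1" | "1 \<le> u" "u \<le> s" | "s \<le> u" using s by linarith
      then show ?thesis
      proof cases
        case 1
        have "K y u \<le> 1 * N1 y * u" using K_le1[of y u] y u by (simp add: mult.commute)
        also have "\<dots> \<le> s * N1 y * u" using s N u by (intro mult_right_mono) auto
        also have "\<dots> \<le> A * u" using A u by (intro mult_right_mono) auto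
        also have "u powr 1 \<le> u powr \<beta>" using 1 u exps by (intro powr_mono') auto
        then have "A * u \<le> A * u powr \<beta>" using A u by (intro mult_left_mono) auto
        also have "u powr \<beta> \<le> u powr \<alpha>" using 1 u exps by (intro powr_mono') auto
        then have "u powr \<beta> = min (u powr \<alpha>) (u powr \<beta>)" by simp
        finally show ?thesis .
      next
        case 2
        have "K y u \<le> u * N1 y" using K_le1[of y u] y u by simp
        also have "\<dots> \<le> s * N1 y" using 2 N by (intro mult_right_mono) auto
        also have "\<dots> \<le> A * 1" using A by simp
        also have "\<dots> \<le> A * min (u powr \<alpha>) (u powr \<beta>)"
          using 2 exps A by (intro mult_left_mono) (auto simp: ge_one_powr_ge_zero)
        finally show ?thesis .
      next
        case 3
        have "K y u \<le> m * u powr \<gamma>" using m u .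
        also have "u powr \<gamma> = u powr (\<gamma> - \<alpha>) * u powr \<alpha>" by (simp flip: powr_add)
        also have "m * \<dots> \<le> m * (s powr (\<gamma> - \<alpha>) * u powr \<alpha>)"
          using 3 s exps m0 by (intro mult_left_mono mult_right_mono powr_mono2') auto
        also have "\<dots> = s powr (\<gamma> - \<alpha>) * m * u powr \<alpha>" by simp
        also have "\<dots> \<le> A * u powr \<alpha>" using A by (intro mult_right_mono) auto
        also have "u powr \<alpha> \<le> u powr \<beta>" using 3 s exps by (intro powr_mono) auto
        then have "u powr \<alpha> = min (u powr \<alpha>) (u powr \<beta>)" by simp
        finally show ?thesis .
      qed
    qed
    then have CA: "K y u \<le> C * A * u powr \<gamma>" if "u > 0" for u using C(2) y A(1) that by blast
    have "m \<le> C * A"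
      unfolding m_def using CA by (intro cSUP_least) (auto simp: divide_le_eq)
    also have "\<dots> = (C * s powr (\<gamma> - \<alpha>)) * m + C * s * N1 y" by (simp add: A_def algebra_simps)
    also have "\<dots> \<le> (1 / 2) * m + C * s * N1 y"
      using mult_right_mono[OF Cs m0] by simp
    finally have "m \<le> 2 * C * s * N1 y" by simp
    then have "m * t powr \<gamma> \<le> 2 * C * s * N1 y * t powr \<gamma>" by (intro mult_right_mono) auto
    then show "K y t \<le> 2 * C * s * N1 y * t powr \<gamma>" using m[OF t] by linarith
  qed
qed

text \<open>Since \<open>\<gamma> < 1\<close>, a large \<open>s\<close> allows splitting
  \<open>y\<close> into an \<open>A0\<close> part bounded by \<open>N1 y\<close> and a remainder
  whose \<open>N1\<close> is smaller by the factor \<open>\<delta>\<close>. Iterating on the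
  remainders writes \<open>y\<close> as a geometric series in \<open>A0\<close>.\<close>

lemma norm_domination:
  assumes M: "0 \<le> M" and \<gamma>: "\<gamma> < 1"
    and growth: "\<And>y t. y \<in> A0 \<inter> A1 \<Longrightarrow> 0 < t \<Longrightarrow> K y t \<le> M * N1 y * t powr \<gamma>"
  obtains C where "0 \<le> C" "\<And>y. y \<in> A0 \<inter> A1 \<Longrightarrow> N0 y \<le> C * N1 y"
proof -
  define \<delta> where "\<delta> = 1 / (2 * c)"
  have \<delta>: "\<delta> > 0" "c * \<delta> \<le> 1 / 2" using c1 by (auto simp: \<delta>_def)
  have "\<delta> \<le> 1 / 2" using c1 by (simp add: \<delta>_def field_simps)
  then have \<delta>1: "\<delta> < 1" by simp
  \<comment> \<open>With this \<open>s\<close> the bound \<open>D\<close> on the \<open>A0\<close>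
    part equals \<open>s * \<delta>\<close>, so the same splitting gives
    \<open>N1 b \<le> \<delta> * N1 y\<close>. Using \<open>M + 1\<close> leaves room for the strict
    inequality that \<open>K_approx\<close> demands.\<close>
  define s where "s = (\<delta> / (M + 1)) powr (1 / (\<gamma> - 1))"
  have s: "s > 0" using \<delta> M by (simp add: s_def)
  have "s powr (\<gamma> - 1) = (\<delta> / (M + 1)) powr ((1 / (\<gamma> - 1)) * (\<gamma> - 1))"
    by (simp add: s_def powr_powr)
  also have "(1 / (\<gamma> - 1)) * (\<gamma> - 1) = 1" using \<gamma> by (simp add: field_simps)
  finally have s1: "(M + 1) * s powr (\<gamma> - 1) = \<delta>" using \<delta> M by simp
  have s\<gamma>: "(M + 1) * s powr \<gamma> = s * \<delta>"
    using s by (simp flip: s1 add: powr_diff)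
  define D where "D = (M + 1) * s powr \<gamma>"
  have D: "D \<ge> 0" using M by (simp add: D_def)
  have "\<exists>b. b \<in> A0 \<inter> A1 \<and> N0 (y - b) \<le> D * N1 y \<and> N1 b \<le> \<delta> * N1 y" if y: "y \<in> A0 \<inter> A1" for y
  \<comment> \<open>For \<open>y = 0\<close> the strict inequality fails, as both sides
    vanish.\<close>
  proof (cases "y = 0")
    case True
    then show ?thesis using zero by (intro exI[of _ 0]) auto
  next
    case False
    then have N: "N1 y > 0" using y n1(2,3)[of y] by auto
    have "K y s \<le> M * N1 y * s powr \<gamma>" using growth y s by blast
    also have "\<dots> < (M + 1) * N1 y * s powr \<gamma>" using N s by (simp add: algebra_simps)
    finally have "K y s < D * N1 y" by (simp add: D_def mult_ac)
    then obtain a b where ab: "a \<in> A0" "b \<in> A1" "y = a + b" "N0 a + s * N1 b < D * N1 y"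
      using K_approx[of y s] y A0_sum by blast
    have nn: "N0 a \<ge> 0" "N1 b \<ge> 0" using ab n0(2) n1(2) by auto
    have "b = y - a" using ab by simp
    then have "b \<in> A0" using subspace_diff[OF n0(1), of y a] ab(1) y by simp
    moreover have "N0 (y - b) \<le> D * N1 y"
    proof -
      have "0 \<le> s * N1 b" using nn s by simp
      then show ?thesis using ab by simp
    qed
    moreover have "N1 b \<le> \<delta> * N1 y"
    proof -
      have "s * N1 b \<le> s * (\<delta> * N1 y)" using ab nn by (simp add: D_def s\<gamma>)
      then show ?thesis using s by simp
    qed
    ultimately show ?thesis using ab by blast
  qed
  then obtain f where f: "\<And>y. y \<in> A0 \<inter> A1 \<Longrightarrow> f y \<in> A0 \<inter> A1"
    "\<And>y. y \<in> A0 \<inter> A1 \<Longrightarrow> N0 (y - f y) \<le> D * N1 y" "\<And>y. y \<in> A0 \<inter> A1 \<Longrightarrow> N1 (f y) \<le> \<delta> * N1 y"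
    by metis
  show thesis
  proof (rule that[of "2 * c\<^sup>2 * D"])
    show "0 \<le> 2 * c\<^sup>2 * D" using D by simp
    fix y assume y: "y \<in> A0 \<inter> A1"
    define r where "r n = (f ^^ n) y" for n
    have r0: "r 0 = y" and rSuc: "r (Suc n) = f (r n)" for n by (simp_all add: r_def)
    have r: "r n \<in> A0 \<inter> A1" for n by (induction n) (use y f in \<open>auto simp: r0 rSuc\<close>)
    have rN: "N1 (r n) \<le> N1 y * \<delta> ^ n" for n
    proof (induction n)
      case (Suc n)
      have "N1 (r (Suc n)) \<le> \<delta> * N1 (r n)" using f r by (simp add: rSuc)
      also have "\<dots> \<le> \<delta> * (N1 y * \<delta> ^ n)" using Suc \<delta> by (intro mult_left_mono) auto
      finally show ?case by (simp add: mult_ac)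
    qed (simp add: r0)
    define b where "b n = r n - r (Suc n)" for n
    have bA: "b n \<in> A0" for n using r n0(1) by (auto simp: b_def intro: subspace_diff)
    have bN: "N0 (b n) \<le> D * N1 y * \<delta> ^ n" for n
    proof -
      have "N0 (b n) \<le> D * N1 (r n)" using f(2)[OF r] by (simp add: b_def rSuc)
      also have "\<dots> \<le> D * (N1 y * \<delta> ^ n)" using rN D by (intro mult_left_mono) auto
      finally show ?thesis by (simp add: mult_ac)
    qed
    have "0 \<le> D * N1 y" using D y n1(2) by simp
    then obtain l where l: "l \<in> A0" "(\<lambda>n. N0 ((\<Sum>k<n. b k) - l)) \<longlonglongrightarrow> 0" "N0 l \<le> 2 * c\<^sup>2 * (D * N1 y)"
      using quasi_banach_series[OF qb(1) tri0 bA bN c1 less_imp_le[OF \<delta>(1)] \<delta>(2)] by blast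
    have sumb: "(\<Sum>k<n. b k) = y - r n" for n by (induction n) (simp_all add: b_def r0)
    \<comment> \<open>The series converges in \<open>A0\<close>, the remainders vanish in
      \<open>A1\<close>; only the ambient Hausdorff topology can compare the two, and it forces
      \<open>y = l\<close>.\<close>
    have "(\<lambda>n. y - r n - l) \<longlonglongrightarrow> 0"
    proof (rule tendsto_ambient(1))
      show "y - r n - l \<in> A0" for n
        using l(1) y r[of n] n0(1) by (simp add: subspace_diff)
      show "(\<lambda>n. N0 (y - r n - l)) \<longlonglongrightarrow> 0" using l(2) by (simp add: sumb)
    qed
    moreover have "r \<longlonglongrightarrow> 0"
    proof (rule tendsto_ambient(2))
      show "r n \<in> A1" for n using r by blast
      show "(\<lambda>n. N1 (r n)) \<longlonglongrightarrow> 0"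
      proof (rule tendsto_sandwich[OF _ _ tendsto_const])
        show "(\<lambda>n. N1 y * \<delta> ^ n) \<longlonglongrightarrow> 0"
          using \<delta> \<delta>1 by (intro tendsto_mult_right_zero LIMSEQ_realpow_zero) auto
      qed (use rN r n1(2) in auto)
    qed
    ultimately have "(\<lambda>n. (y - r n - l) + r n) \<longlonglongrightarrow> 0 + 0" by (rule tendsto_add)
    then have "y = l" by (simp add: LIMSEQ_const_iff)
    then show "N0 y \<le> 2 * c\<^sup>2 * D * N1 y" using l by (simp add: mult_ac)
  qed
qed

section \<open>Closedness of the intersection\<close>

text \<open>If \<open>y\<close> in the intersection is split as \<open>a + b\<close>, both parts lie
  there too, so \<open>N0 a + N1 b\<close> controls either quasi-norm of \<open>y\<close>. A
  sequence in the intersection converging in the sum is therefore Cauchy in both spaces.\<close>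

lemma closedin_inter:
  assumes C: "0 \<le> C" and dom: "\<And>y. y \<in> A0 \<inter> A1 \<Longrightarrow> N0 y \<le> C * N1 y"
    "\<And>y. y \<in> A0 \<inter> A1 \<Longrightarrow> N1 y \<le> C * N0 y"
  shows "closedin (quasi_norm_topology \<Sigma> (sum_qnorm A0 N0 A1 N1)) (A0 \<inter> A1)"
proof -
  define Q where "Q = (\<lambda>x. K x 1)"
  have Q: "sum_qnorm A0 N0 A1 N1 = Q" by (simp add: fun_eq_iff sum_qnorm_def Q_def)
  have NQ: "N0 y \<le> c * (1 + C) * B" "N1 y \<le> c * (1 + C) * B" if y: "y \<in> A0 \<inter> A1" "Q y < B" for y B
  proof -
    obtain a b where ab: "a \<in> A0" "b \<in> A1" "y = a + b" "N0 a + 1 * N1 b < B"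
      using K_approx[of y 1 B] y A0_sum by (auto simp: Q_def)
    have "a = y - b" "b = y - a" using ab by auto
    then have ab': "a \<in> A1" "b \<in> A0"
      using subspace_diff[OF n1(1), of y b] subspace_diff[OF n0(1), of y a] ab(1,2) y by simp_all
    have nn: "N0 a \<ge> 0" "N1 b \<ge> 0" using ab n0(2) n1(2) by auto
    have CB: "C * N0 a + C * N1 b \<le> C * B"
      using ab(4) C by (simp flip: distrib_left add: mult_left_mono)
    have "N0 y \<le> c * (N0 a + N0 b)" using tri0 ab ab' by blast
    also have "\<dots> \<le> c * (N0 a + C * N1 b)" using dom ab ab' c1 by (intro mult_left_mono add_mono) auto
    also have "\<dots> \<le> c * (B + C * B)"
      using CB ab(4) nn C c1 by (intro mult_left_mono) (auto intro: add_nonneg_nonneg simp: add_mono mult_left_mono)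
    finally show "N0 y \<le> c * (1 + C) * B" by (simp add: algebra_simps)
    have "N1 y \<le> c * (N1 a + N1 b)" using tri1 ab ab' by blast
    also have "\<dots> \<le> c * (C * N0 a + N1 b)" using dom ab ab' c1 by (intro mult_left_mono add_mono) auto
    also have "\<dots> \<le> c * (C * B + B)"
      using CB ab(4) nn C c1 by (intro mult_left_mono) (auto intro: add_nonneg_nonneg simp: add_mono mult_left_mono)
    finally show "N1 y \<le> c * (1 + C) * B" by (simp add: algebra_simps)
  qed
  have "\<exists>e>0. {y \<in> \<Sigma>. Q (y - x) < e} \<subseteq> \<Sigma> - A0 \<inter> A1" if x: "x \<in> \<Sigma>" "x \<notin> A0 \<inter> A1" for x
  proof (rule ccontr)
    assume "\<not> ?thesis"
    then have "\<exists>y\<in>A0 \<inter> A1. Q (y - x) < inverse (real (Suc n))" for n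
      using A0_sum by (metis (no_types, lifting) Diff_iff mem_Collect_eq subsetI inverse_positive_iff_positive of_nat_0_less_iff zero_less_Suc)
    then obtain y where y: "\<And>n. y n \<in> A0 \<inter> A1" "\<And>n. Q (y n - x) < inverse (real (Suc n))" by metis
    have yS: "y n \<in> \<Sigma>" for n using y A0_sum by blast
    have yx: "y n - x \<in> \<Sigma>" for n using yS x subspace_sum_space by (simp add: subspace_diff)
    have ydiff: "y m - y n \<in> A0 \<inter> A1" for m n using y subspace_inter by (intro subspace_diff) auto
    have Qd: "Q (y m - y n) < 2 * c * inverse (real (Suc M))" if "m \<ge> M" "n \<ge> M" for m n M
    proof -
      have inv: "inverse (real (Suc m)) \<le> inverse (real (Suc M))" "inverse (real (Suc n)) \<le> inverse (real (Suc M))"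
        using that by auto
      have "Q (y m - y n) \<le> c * (Q (y m - x) + Q (x - y n))"
        using K_triangle[of "y m - x" "x - y n" 1] yx yS x subspace_sum_space
        by (simp add: Q_def subspace_diff)
      also have "Q (x - y n) = Q (y n - x)" unfolding Q_def using x yS by (intro K_commute) auto
      also have "c * (Q (y m - x) + Q (y n - x)) < c * (inverse (real (Suc M)) + inverse (real (Suc M)))"
        using y(2)[of m] y(2)[of n] c1
        by (intro mult_strict_left_mono add_strict_mono less_le_trans[OF _ inv(1)] less_le_trans[OF _ inv(2)]) auto
      finally show ?thesis by (simp add: algebra_simps)
    qed
    define B where "B = c * (1 + C) * (2 * c)"
    have B: "B > 0" using c1 C by (simp add: B_def)
    have small: "N0 (y m - y n) \<le> B * inverse (real (Suc M))" "N1 (y m - y n) \<le> B * inverse (real (Suc M))"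
      if "m \<ge> M" "n \<ge> M" for m n M
      using NQ[OF ydiff Qd[OF that]] by (simp_all only: B_def mult.assoc)
    have ex: "\<exists>M. B * inverse (real (Suc M)) < e" if "e > 0" for e
    proof -
      obtain M where "inverse (real (Suc M)) < e / B" using reals_Archimedean[of "e / B"] B \<open>e > 0\<close> by auto
      then show ?thesis using B by (intro exI[of _ M]) (simp add: field_simps)
    qed
    have cauchy: "\<forall>e>0. \<exists>M. \<forall>m\<ge>M. \<forall>n\<ge>M. N (y m - y n) < e"
      if "\<And>m n M. m \<ge> M \<Longrightarrow> n \<ge> M \<Longrightarrow> N (y m - y n) \<le> B * inverse (real (Suc M))" for N
      using ex that by (meson le_less_trans)
    have "\<exists>l\<in>A0. (\<lambda>n. N0 (y n - l)) \<longlonglongrightarrow> 0"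
      using qb(1) cauchy[of N0] small(1) y(1) unfolding quasi_banach_on_def quasi_norm_complete_def by blast
    then obtain l0 where l0: "l0 \<in> A0" "(\<lambda>n. N0 (y n - l0)) \<longlonglongrightarrow> 0" by blast
    have "\<exists>l\<in>A1. (\<lambda>n. N1 (y n - l)) \<longlonglongrightarrow> 0"
      using qb(2) cauchy[of N1] small(2) y(1) unfolding quasi_banach_on_def quasi_norm_complete_def by blast
    then obtain l1 where l1: "l1 \<in> A1" "(\<lambda>n. N1 (y n - l1)) \<longlonglongrightarrow> 0" by blast
    have "(\<lambda>n. y n - l0) \<longlonglongrightarrow> 0"
      using l0 y(1) n0(1) by (intro tendsto_ambient(1)) (auto intro: subspace_diff)
    then have y0: "y \<longlonglongrightarrow> l0" using tendsto_add[OF _ tendsto_const[of l0]] by fastforce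
    have "(\<lambda>n. y n - l1) \<longlonglongrightarrow> 0"
      using l1 y(1) n1(1) by (intro tendsto_ambient(2)) (auto intro: subspace_diff)
    then have y1: "y \<longlonglongrightarrow> l1" using tendsto_add[OF _ tendsto_const[of l1]] by fastforce
    \<comment> \<open>Near-optimal splittings turn convergence in the sum into ambient convergence,
      so \<open>x\<close> must equal both \<open>l0\<close> and \<open>l1\<close>.\<close>
    have "\<exists>a b. a \<in> A0 \<and> b \<in> A1 \<and> y n - x = a + b \<and> N0 a \<le> inverse (real (Suc n)) \<and> N1 b \<le> inverse (real (Suc n))" for n
    proof -
      obtain a b where ab: "a \<in> A0" "b \<in> A1" "y n - x = a + b" "N0 a + 1 * N1 b < inverse (real (Suc n))"
        using K_approx[OF yx, of n 1] y(2)[of n] unfolding Q_def by blast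
      moreover have "N0 a \<ge> 0" "N1 b \<ge> 0" using ab n0(2) n1(2) by auto
      ultimately have "N0 a \<le> inverse (real (Suc n))" "N1 b \<le> inverse (real (Suc n))" by auto
      then show ?thesis using ab by blast
    qed
    then obtain a b where ab: "\<And>n. a n \<in> A0" "\<And>n. b n \<in> A1" "\<And>n. y n - x = a n + b n"
      "\<And>n. N0 (a n) \<le> inverse (real (Suc n))" "\<And>n. N1 (b n) \<le> inverse (real (Suc n))" by metis
    have "(\<lambda>n. N0 (a n)) \<longlonglongrightarrow> 0"
      by (rule tendsto_sandwich[OF _ _ tendsto_const LIMSEQ_inverse_real_of_nat]) (use ab n0(2) in auto)
    then have "a \<longlonglongrightarrow> 0" using ab tendsto_ambient(1) by blast
    moreover have "(\<lambda>n. N1 (b n)) \<longlonglongrightarrow> 0"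
      by (rule tendsto_sandwich[OF _ _ tendsto_const LIMSEQ_inverse_real_of_nat]) (use ab n1(2) in auto)
    then have "b \<longlonglongrightarrow> 0" using ab tendsto_ambient(2) by blast
    ultimately have "(\<lambda>n. y n - x) \<longlonglongrightarrow> 0 + 0" unfolding ab(3) by (rule tendsto_add)
    then have "y \<longlonglongrightarrow> x" using tendsto_add[OF _ tendsto_const[of x]] by fastforce
    then have "x = l0" "x = l1" using LIMSEQ_unique y0 y1 by auto
    then show False using x l0 l1 by simp
  qed
  then show ?thesis
    unfolding closedin_def Q openin_quasi_norm_topology using A0_sum by auto
qed

section \<open>Interpolation spaces and power bounds on the K-functional\<close>

text \<open>Factor \<open>t\<close> out of \<open>N1 b + t * N0 a\<close>. A bound with exponent
  \<open>\<theta>\<close> for one couple becomes one with \<open>1 - \<theta>\<close> for the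
  other.\<close>

lemma K_swap:
  assumes "x \<in> \<Sigma>" "0 < t"
  shows "K_functional A1 N1 A0 N0 x t = t * K x (1 / t)"
proof -
  interpret S: quasi_couple A1 N1 A0 N0 c by (rule swap)
  have xS: "x \<in> S.\<Sigma>" using assms(1) by (force simp: sum_space_def add.commute)
  show ?thesis
  proof (rule antisym)
    have "S.K x t / t \<le> K x (1 / t)"
    proof (rule K_greatest[OF assms(1)])
      fix a b assume ab: "a \<in> A0" "b \<in> A1" "x = a + b"
      then have "S.K x t \<le> N1 b + t * N0 a" using S.K_le[of b a t] assms(2) by (simp add: add.commute)
      then show "S.K x t / t \<le> N0 a + 1 / t * N1 b" using assms(2) by (simp add: field_simps)
    qed
    then show "S.K x t \<le> t * K x (1 / t)" using assms(2) by (simp add: field_simps)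
    show "t * K x (1 / t) \<le> S.K x t"
    proof (rule S.K_greatest[OF xS])
      fix b a assume ab: "b \<in> A1" "a \<in> A0" "x = b + a"
      then have "K x (1 / t) \<le> N0 a + 1 / t * N1 b" using K_le[of a b "1 / t"] assms(2) by (simp add: add.commute)
      then show "t * K x (1 / t) \<le> N1 b + t * N0 a" using assms(2) by (simp add: field_simps)
    qed
  qed
qed

text \<open>As \<open>K x\<close> is increasing, the part of the integral over
  \<open>{t..2 * t}\<close> alone bounds \<open>K x t\<close>.\<close>

lemma K_bound_of_interp:
  assumes x: "x \<in> interp_space A0 N0 A1 N1 \<theta> p" and p: "0 < p" and \<theta>: "0 \<le> \<theta>"
  shows "\<exists>A. \<forall>t>0. K x t \<le> A * t powr \<theta>"
proof -
  define I where "I = (\<integral>\<^sup>+t\<in>{0<..}. ennreal ((t powr (- \<theta>) * K x t) powr p / t) \<partial>lborel)"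
  have xS: "x \<in> \<Sigma>" and "I < \<infinity>" using x by (auto simp: mem_interp_space_iff I_def)
  then obtain r where r: "I = ennreal r" "r \<ge> 0" by (cases I) auto
  have "K x t \<le> (2 * r) powr (1 / p) * 2 powr \<theta> * t powr \<theta>" if t: "t > 0" for t
  proof -
    \<comment> \<open>A lower bound on the whole interval: the power is smallest at
      \<open>2 * t\<close>, \<open>K x\<close> at \<open>t\<close>.\<close>
    define k where "k = (2 * t) powr (- \<theta>) * K x t"
    have k: "k \<ge> 0" using K_nonneg[OF xS, of t] t by (simp add: k_def)
    have "ennreal (k powr p / 2) = ennreal (k powr p / (2 * t)) * ennreal t"
      using t by (simp flip: ennreal_mult)
    also have "\<dots> = (\<integral>\<^sup>+u. ennreal (k powr p / (2 * t)) * indicator {t..2 * t} u \<partial>lborel)"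
      using t by (simp add: nn_integral_cmult_indicator)
    also have "\<dots> \<le> I"
      unfolding I_def
    proof (rule nn_integral_mono)
      fix u :: real
      show "ennreal (k powr p / (2 * t)) * indicator {t..2 * t} u
        \<le> ennreal ((u powr (- \<theta>) * K x u) powr p / u) * indicator {0<..} u"
      proof (cases "u \<in> {t..2 * t}")
        case True
        have "k \<le> u powr (- \<theta>) * K x u"
          unfolding k_def using True t \<theta> K_mono[OF xS, of t u] K_nonneg[OF xS, of t]
          by (intro mult_mono powr_mono2') auto
        then have "k powr p / (2 * t) \<le> (u powr (- \<theta>) * K x u) powr p / u"
          using True t p k by (intro frac_le powr_mono2) auto
        then show ?thesis using True t by (simp add: ennreal_leI)
      qed simp
    qed
    finally have "k powr p \<le> 2 * r" using r by simp
    then have "(k powr p) powr (1 / p) \<le> (2 * r) powr (1 / p)" using p by (intro powr_mono2) auto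
    then have "k \<le> (2 * r) powr (1 / p)" using p k by (simp add: powr_powr)
    then have "(2 * t) powr \<theta> * k \<le> (2 * t) powr \<theta> * (2 * r) powr (1 / p)"
      by (intro mult_left_mono) auto
    moreover have "(2 * t) powr \<theta> * k = K x t" using t by (simp add: k_def powr_minus)
    moreover have "(2 * t) powr \<theta> = 2 powr \<theta> * t powr \<theta>" using t by (simp add: powr_mult)
    ultimately show ?thesis by (metis mult.assoc mult.commute)
  qed
  then show ?thesis by blast
qed

text \<open>The integral is split at 1. With \<open>e \<gamma>\<close> the exponent resulting from
  growth \<open>t powr \<gamma>\<close>, \<open>e \<beta> > -1\<close> gives integrability at 0 and
  \<open>e \<alpha> < -1\<close> at infinity.\<close>

lemma interp_of_K_bound:
  assumes x: "x \<in> \<Sigma>" and K: "\<And>t. 0 < t \<Longrightarrow> K x t \<le> A * min (t powr \<alpha>) (t powr \<beta>)"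
    and \<theta>: "\<alpha> < \<theta>" "\<theta> < \<beta>" and p: "0 < p"
  shows "x \<in> interp_space A0 N0 A1 N1 \<theta> p"
proof -
  define e where "e \<gamma> = (\<gamma> - \<theta>) * p - 1" for \<gamma>
  have pw: "(t powr (- \<theta>) * K x t) powr p / t \<le> A powr p * t powr e \<gamma>"
    if t: "t > 0" and le: "K x t \<le> A * t powr \<gamma>" for t \<gamma>
  proof -
    have nn: "0 \<le> K x t" using K_nonneg x t by simp
    then have "0 \<le> A * t powr \<gamma>" using le by linarith
    then have A: "A \<ge> 0" using t by (simp add: zero_le_mult_iff)
    have "t powr (- \<theta>) * K x t \<le> t powr (- \<theta>) * (A * t powr \<gamma>)" using le by (intro mult_left_mono) auto
    also have "\<dots> = A * t powr (\<gamma> - \<theta>)" by (simp add: powr_diff powr_minus_divide)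
    finally have "(t powr (- \<theta>) * K x t) powr p \<le> (A * t powr (\<gamma> - \<theta>)) powr p"
      using nn p by (intro powr_mono2) auto
    also have "\<dots> = A powr p * t powr ((\<gamma> - \<theta>) * p)" using A by (simp add: powr_mult powr_powr)
    also have "\<dots> = A powr p * t powr e \<gamma> * t" using t by (simp add: e_def powr_diff)
    finally show ?thesis using t by (simp add: divide_le_eq)
  qed
  have b: "(\<integral>\<^sup>+t. ennreal (t powr e \<beta>) * indicator {0..1} t \<partial>lborel) < \<infinity>"
    using has_integral_powr_from_0[of "e \<beta>" 1] \<theta> p
    by (subst nn_integral_has_integral_lebesgue') (auto simp: e_def)
  have a: "(\<integral>\<^sup>+t. ennreal (t powr e \<alpha>) * indicator {1..} t \<partial>lborel) < \<infinity>"
    using has_integral_powr_to_inf[of "e \<alpha>" 1] \<theta> p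
    by (subst nn_integral_has_integral_lebesgue') (auto simp: e_def mult_neg_pos)
  have "(\<integral>\<^sup>+t\<in>{0<..}. ennreal ((t powr (- \<theta>) * K x t) powr p / t) \<partial>lborel)
      \<le> (\<integral>\<^sup>+t. ennreal (A powr p) * (ennreal (t powr e \<beta>) * indicator {0..1} t)
        + ennreal (A powr p) * (ennreal (t powr e \<alpha>) * indicator {1..} t) \<partial>lborel)"
  proof (rule nn_integral_mono)
    fix t :: real
    consider "t \<le> 0" | "0 < t" "t \<le> 1" | "1 < t" by linarith
    then show "ennreal ((t powr (- \<theta>) * K x t) powr p / t) * indicator {0<..} t
      \<le> ennreal (A powr p) * (ennreal (t powr e \<beta>) * indicator {0..1} t)
        + ennreal (A powr p) * (ennreal (t powr e \<alpha>) * indicator {1..} t)"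
    proof cases
      case 2
      then have "min (t powr \<alpha>) (t powr \<beta>) = t powr \<beta>" using \<theta> by (simp add: powr_mono')
      then have "(t powr (- \<theta>) * K x t) powr p / t \<le> A powr p * t powr e \<beta>"
        using 2 K[of t] by (intro pw) auto
      then have "ennreal ((t powr (- \<theta>) * K x t) powr p / t) \<le> ennreal (A powr p) * ennreal (t powr e \<beta>)"
        by (simp flip: ennreal_mult add: ennreal_leI)
      then show ?thesis using 2 by (auto simp: add_increasing2)
    next
      case 3
      then have "min (t powr \<alpha>) (t powr \<beta>) = t powr \<alpha>" using \<theta> by (simp add: powr_mono)
      then have "(t powr (- \<theta>) * K x t) powr p / t \<le> A powr p * t powr e \<alpha>"
        using 3 K[of t] by (intro pw) auto
      then have "ennreal ((t powr (- \<theta>) * K x t) powr p / t) \<le> ennreal (A powr p) * ennreal (t powr e \<alpha>)"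
        by (simp flip: ennreal_mult add: ennreal_leI)
      then show ?thesis using 3 by simp
    qed simp
  qed
  also have "\<dots> = ennreal (A powr p) * (\<integral>\<^sup>+t. ennreal (t powr e \<beta>) * indicator {0..1} t \<partial>lborel)
      + ennreal (A powr p) * (\<integral>\<^sup>+t. ennreal (t powr e \<alpha>) * indicator {1..} t \<partial>lborel)"
    by (simp add: nn_integral_add nn_integral_cmult)
  also have "\<dots> < \<infinity>" using a b by (simp add: ennreal_mult_less_top)
  finally show ?thesis using x by (simp add: mem_interp_space_iff)
qed

text \<open>Growth bounded by the two powers puts \<open>x\<close> into the space for
  \<open>\<theta>1\<close>, hence into that for \<open>\<theta>0\<close>, and so bounds
  \<open>K x\<close> by a multiple of \<open>t powr \<theta>0\<close>; this is the hypothesis of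
  \<open>norm_growth\<close>.\<close>

lemma norm_domination_of_interp_subset:
  assumes "0 \<le> \<theta>0" "\<theta>0 < \<theta>1" "\<theta>1 < 1" "0 < p" "0 < q"
    and sub: "interp_space A0 N0 A1 N1 \<theta>1 q \<subseteq> interp_space A0 N0 A1 N1 \<theta>0 p"
  obtains C where "0 \<le> C" "\<And>y. y \<in> A0 \<inter> A1 \<Longrightarrow> N0 y \<le> C * N1 y"
proof -
  define \<alpha> \<beta> where "\<alpha> = (\<theta>0 + \<theta>1) / 2" and "\<beta> = (\<theta>1 + 1) / 2"
  have ab: "\<theta>0 < \<alpha>" "\<alpha> < \<theta>1" "\<theta>1 < \<beta>" "\<beta> \<le> 1" using assms by (auto simp: \<alpha>_def \<beta>_def)
  have growth: "\<exists>A. \<forall>t>0. K x t \<le> A * t powr \<theta>0"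
    if "x \<in> \<Sigma>" "\<And>t. 0 < t \<Longrightarrow> K x t \<le> A * min (t powr \<alpha>) (t powr \<beta>)" for x A
    using interp_of_K_bound[OF that ab(2,3), of q] sub assms K_bound_of_interp[of x \<theta>0 p] by blast
  obtain M where "0 \<le> M" "\<And>y t. y \<in> A0 \<inter> A1 \<Longrightarrow> 0 < t \<Longrightarrow> K y t \<le> M * N1 y * t powr \<theta>0"
  proof (rule norm_growth[of \<theta>0 \<alpha> \<beta>])
    show "\<exists>A. \<forall>t>0. K x t \<le> A * t powr \<theta>0"
      if "x \<in> \<Sigma>" "\<And>t. 0 < t \<Longrightarrow> K x t \<le> A * min (t powr \<alpha>) (t powr \<beta>)" for x A
      using that by (rule growth)
  qed (use ab assms in auto)
  then show thesis using norm_domination[of M \<theta>0] that assms by auto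
qed

text \<open>The previous argument for the reversed couple, where every exponent is replaced by its
  complement to 1, so that \<open>1 - \<theta>1\<close> takes the place of the smaller
  exponent.\<close>

lemma norm_domination_of_interp_superset:
  assumes "0 < \<theta>0" "\<theta>0 < \<theta>1" "\<theta>1 < 1" "0 < p" "0 < q"
    and sub: "interp_space A0 N0 A1 N1 \<theta>0 p \<subseteq> interp_space A0 N0 A1 N1 \<theta>1 q"
  obtains C where "0 \<le> C" "\<And>y. y \<in> A0 \<inter> A1 \<Longrightarrow> N1 y \<le> C * N0 y"
proof -
  interpret S: quasi_couple A1 N1 A0 N0 c by (rule swap)
  have S_sum: "S.\<Sigma> = \<Sigma>" by (force simp: sum_space_def add.commute)
  define \<alpha> \<beta> where "\<alpha> = \<theta>0 / 2" and "\<beta> = (\<theta>0 + \<theta>1) / 2"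
  have ab: "0 < \<alpha>" "\<alpha> < \<theta>0" "\<theta>0 < \<beta>" "\<beta> < \<theta>1" using assms by (auto simp: \<alpha>_def \<beta>_def)
  have growth: "\<exists>A. \<forall>t>0. S.K x t \<le> A * t powr (1 - \<theta>1)"
    if x: "x \<in> S.\<Sigma>" and le: "\<And>t. 0 < t \<Longrightarrow> S.K x t \<le> A * min (t powr (1 - \<beta>)) (t powr (1 - \<alpha>))" for x A
  proof -
    have xS: "x \<in> \<Sigma>" using x S_sum by simp
    have "K x t \<le> A * min (t powr \<alpha>) (t powr \<beta>)" if t: "t > 0" for t
    proof -
      \<comment> \<open>Passing to \<open>1 / t\<close> sends the two reversed powers back to
        \<open>t powr \<beta>\<close> and \<open>t powr \<alpha>\<close>.\<close>
      have flip: "t * (1 / t) powr (1 - \<gamma>) = t powr \<gamma>" for \<gamma>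
        using t by (simp add: powr_divide powr_diff)
      have "K x t = t * S.K x (1 / t)" using S.K_swap[OF x t] .
      also have "\<dots> \<le> t * (A * min ((1 / t) powr (1 - \<beta>)) ((1 / t) powr (1 - \<alpha>)))"
        using le[of "1 / t"] t by (intro mult_left_mono) auto
      also have "\<dots> = A * (t * min ((1 / t) powr (1 - \<beta>)) ((1 / t) powr (1 - \<alpha>)))" by simp
      also have "t * min ((1 / t) powr (1 - \<beta>)) ((1 / t) powr (1 - \<alpha>)) = min (t powr \<beta>) (t powr \<alpha>)"
        unfolding min_mult_distrib_left flip using t by simp
      finally show ?thesis by (simp add: min.commute)
    qed
    then have "x \<in> interp_space A0 N0 A1 N1 \<theta>1 q"
      using interp_of_K_bound[OF xS _ ab(2,3) \<open>0 < p\<close>] sub by blast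
    then obtain A where A: "\<And>t. t > 0 \<Longrightarrow> K x t \<le> A * t powr \<theta>1"
      using K_bound_of_interp[of x \<theta>1 q] assms by auto
    have "S.K x t \<le> A * t powr (1 - \<theta>1)" if t: "t > 0" for t
    proof -
      have "S.K x t = t * K x (1 / t)" using K_swap[OF xS t] .
      also have "\<dots> \<le> t * (A * (1 / t) powr \<theta>1)" using A[of "1 / t"] t by (intro mult_left_mono) auto
      also have "\<dots> = A * t powr (1 - \<theta>1)" using t by (simp add: powr_divide powr_diff)
      finally show ?thesis .
    qed
    then show ?thesis by blast
  qed
  obtain M where "0 \<le> M" "\<And>y t. y \<in> A1 \<inter> A0 \<Longrightarrow> 0 < t \<Longrightarrow> S.K y t \<le> M * N0 y * t powr (1 - \<theta>1)"
  proof (rule S.norm_growth[of "1 - \<theta>1" "1 - \<beta>" "1 - \<alpha>"])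
    show "\<exists>A. \<forall>t>0. S.K x t \<le> A * t powr (1 - \<theta>1)"
      if "x \<in> S.\<Sigma>" "\<And>t. 0 < t \<Longrightarrow> S.K x t \<le> A * min (t powr (1 - \<beta>)) (t powr (1 - \<alpha>))" for x A
      using that by (rule growth)
  qed (use ab assms in auto)
  then obtain C where "0 \<le> C" "\<And>y. y \<in> A1 \<inter> A0 \<Longrightarrow> N1 y \<le> C * N0 y"
    using S.norm_domination[of M "1 - \<theta>1"] assms by auto
  then show thesis using that by blast
qed

end

section \<open>Coincidence of two interpolation spaces\<close>

text \<open>Each inclusion contained in the equality yields one of the two inequalities between
  \<open>N0\<close> and \<open>N1\<close> on the intersection.\<close>

theorem closedin_inter_of_interp_eq:
  assumes couple: "quasi_banach_couple A0 N0 A1 N1"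
    and exps: "0 < \<theta>0" "\<theta>0 < \<theta>1" "\<theta>1 < 1" "0 < p" "0 < q"
    and eq: "interp_space A0 N0 A1 N1 \<theta>0 p = interp_space A0 N0 A1 N1 \<theta>1 q"
  shows "closedin (quasi_norm_topology (sum_space A0 A1) (sum_qnorm A0 N0 A1 N1)) (A0 \<inter> A1)"
proof -
  have qn: "quasi_norm_on A0 N0" "quasi_norm_on A1 N1"
    using couple by (auto simp: quasi_banach_couple_def quasi_banach_on_def)
  obtain c0 c1 where c0: "c0 \<ge> 1" "\<And>x y. x \<in> A0 \<Longrightarrow> y \<in> A0 \<Longrightarrow> N0 (x + y) \<le> c0 * (N0 x + N0 y)"
    and c1: "c1 \<ge> 1" "\<And>x y. x \<in> A1 \<Longrightarrow> y \<in> A1 \<Longrightarrow> N1 (x + y) \<le> c1 * (N1 x + N1 y)"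
    using qn unfolding quasi_norm_on_def by metis
  interpret quasi_couple A0 N0 A1 N1 "max c0 c1"
  proof
    show "N0 (x + y) \<le> max c0 c1 * (N0 x + N0 y)" if "x \<in> A0" "y \<in> A0" for x y
      using c0(2)[OF that] quasi_norm_onD(2)[OF qn(1)] that
      by (smt (verit) max.cobounded1 mult_right_mono)
    show "N1 (x + y) \<le> max c0 c1 * (N1 x + N1 y)" if "x \<in> A1" "y \<in> A1" for x y
      using c1(2)[OF that] quasi_norm_onD(2)[OF qn(2)] that
      by (smt (verit) max.cobounded2 mult_right_mono)
  qed (use couple c0 in auto)
  obtain C where C: "0 \<le> C" "\<And>y. y \<in> A0 \<inter> A1 \<Longrightarrow> N0 y \<le> C * N1 y"
    using norm_domination_of_interp_subset[of \<theta>0 \<theta>1 p q] exps eq by auto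
  obtain C' where C': "0 \<le> C'" "\<And>y. y \<in> A0 \<inter> A1 \<Longrightarrow> N1 y \<le> C' * N0 y"
    using norm_domination_of_interp_superset[of \<theta>0 \<theta>1 p q] exps eq by auto
  show ?thesis
  proof (rule closedin_inter[of "max C C'"])
    show "N0 y \<le> max C C' * N1 y" if y: "y \<in> A0 \<inter> A1" for y
    proof -
      have "C * N1 y \<le> max C C' * N1 y" using n1(2) y by (intro mult_right_mono) auto
      then show ?thesis using C(2)[OF y] by linarith
    qed
    show "N1 y \<le> max C C' * N0 y" if y: "y \<in> A0 \<inter> A1" for y
    proof -
      have "C' * N0 y \<le> max C C' * N0 y" using n0(2) y by (intro mult_right_mono) auto
      then show ?thesis using C'(2)[OF y] by linarith
    qed
  qed (use C in auto)
qed

theorem theorem2p9: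
  fixes A0 A1 :: "'a::hausdorff_tvs set" and N0 N1 :: "'a \<Rightarrow> real"
  assumes couple: "quasi_banach_couple A0 N0 A1 N1"
    and not_closed: "\<not> closedin (quasi_norm_topology (sum_space A0 A1) (sum_qnorm A0 N0 A1 N1)) (A0 \<inter> A1)"
  shows "(\<forall>\<theta>0 \<theta>1 p q :: real.
            0 < \<theta>0 \<and> \<theta>0 < 1/2 \<and> 1/2 < \<theta>1 \<and> \<theta>1 < 1 \<and> 0 < p \<and> 0 < q \<longrightarrow>
            interp_space A0 N0 A1 N1 \<theta>0 p \<noteq> interp_space A0 N0 A1 N1 \<theta>1 q) \<and>
         (\<forall>\<theta>0 \<theta>1 p q :: real.
            0 < p \<and> 0 < q \<and>
            (0 < \<theta>0 \<and> \<theta>0 < \<theta>1 \<and> \<theta>1 \<le> 1/2 \<or> 1/2 \<le> \<theta>0 \<and> \<theta>0 < \<theta>1 \<and> \<theta>1 < 1) \<and>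
            interp_space A0 N0 A1 N1 \<theta>0 p = interp_space A0 N0 A1 N1 \<theta>1 q \<longrightarrow>
            (\<forall>\<theta>\<in>{\<theta>0..\<theta>1}. \<forall>\<theta>'\<in>{\<theta>0..\<theta>1}. \<forall>r r'. 0 < r \<and> 0 < r' \<longrightarrow>
               interp_space A0 N0 A1 N1 \<theta> r = interp_space A0 N0 A1 N1 \<theta>' r') \<and>
            (\<forall>\<phi>0\<in>{\<theta>0..\<theta>1}. \<forall>\<phi>1\<in>{\<theta>0..\<theta>1}. \<forall>r0 r1. \<phi>0 \<noteq> \<phi>1 \<and> 0 < r0 \<and> 0 < r1 \<longrightarrow>
               interp_space A1 N1 A0 N0 \<phi>0 r0 \<noteq> interp_space A1 N1 A0 N0 \<phi>1 r1))"
proof -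
  have neq: "interp_space A0 N0 A1 N1 \<theta>0 p \<noteq> interp_space A0 N0 A1 N1 \<theta>1 q"
    if "0 < \<theta>0" "\<theta>0 < \<theta>1" "\<theta>1 < 1" "0 < p" "0 < q" for \<theta>0 \<theta>1 p q
    using closedin_inter_of_interp_eq[OF couple that] not_closed by blast
  show ?thesis
    \<comment> \<open>All cases satisfy \<open>0 < \<theta>0\<close>,
      \<open>\<theta>0 < \<theta>1\<close> and \<open>\<theta>1 < 1\<close>, so \<open>neq\<close>
      is the first conjunct and contradicts the equality assumed in the second.\<close>
    by (rule conjI; intro allI impI) (use neq in fastforce)+
qed

end
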